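(* Let $\mathcal{D}$ be an isotropic distribution on $\mathbb{R}^{d}$ with $\mathbb{P}_{\omega\sim\mathcal{D}}(\omega=0)=0$, let $\mathbf{z}\in\mathbb{R}^d$, let $f$ belong to class F1, and let $X=f(\omega^\top\mathbf{z})$ with $\omega\sim\mathcal{D}$. Then $\widehat{F}^{\mathrm{ort}}_{f,\mathcal{D}}(\mathbf{z})$ is an unbiased estimator of $F_{f,\mathcal{D}}(\mathbf{z})$, and for every $\epsilon>0$, $$\mathbb{P}\big[|\widehat{F}^{\mathrm{ort}}_{f,\mathcal{D}}(\mathbf{z})-F_{f,\mathcal{D}}(\mathbf{z})|\ge\epsilon\big]\le p(\epsilon),$$ where $p(\epsilon)=\exp(-s\mathcal{L}_X(F_{f,\mathcal{D}}(\mathbf{z})+\epsilon))+\exp(-s\mathcal{L}_X(F_{f,\mathcal{D}}(\mathbf{z})-\epsilon))$ in general, and, if $f$ takes values in $[a,b]$, one may take $p(\epsilon)=2\exp\big(-\frac{2s\epsilon^2}{(b-a)^2}\big)$. (These are the standard Cramér–Chernoff and Hoeffding upper bounds for $\mathbb{P}[|\widehat{F}^{\mathrm{iid}}_{f,\mathcal{D}}(\mathbf{z})-F_{f,\mathcal{D}}(\mathbf{z})|\ge\epsilon]$.) Moreover, if $\mathbb{E}[X^2]<\infty$, then $\mathrm{MSE}(\widehat{F}^{\mathrm{ort}}_{f,\mathcal{D}}(\mathbf{z}))\le\mathrm{MSE}(\widehat{F}^{\mathrm{iid}}_{f,\mathcal{D}}(\mathbf{z}))$.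
   Context: Isotropic: $Q\omega\overset{d}{=}\omega$ for $\omega\sim\mathcal{D}$ and every orthogonal $Q$. An orthogonal ensemble for $\mathcal{D}$ of size $m\le d$ is $l_iv_i$ ($i=1,\dots,m$), with $v_1,\dots,v_d$ the rows of a Haar-random orthogonal $d\times d$ matrix and $l_i$ i.i.d. copies of $\|\omega\|_2$ ($\omega\sim\mathcal{D}$) independent of the $v_i$. For general $s$, the (block-)orthogonal ensemble $\omega^{\mathrm{ort}}_1,\dots,\omega^{\mathrm{ort}}_s$ partitions $1,\dots,s$ into blocks of size at most $d$, each an orthogonal ensemble, different blocks independent; $\omega^{\mathrm{iid}}_1,\dots,\omega^{\mathrm{iid}}_s$ are i.i.d. from $\mathcal{D}$. $F_{f,\mathcal{D}}(\mathbf{z})=\mathbb{E}_{\omega\sim\mathcal{D}}[f(\omega^\top\mathbf{z})]$, $\widehat{F}^{\mathrm{iid}}_{f,\mathcal{D}}(\mathbf{z})=\frac1s\sum_i f((\omega^{\mathrm{iid}}_i)^\top\mathbf{z})$, $\widehat{F}^{\mathrm{ort}}_{f,\mathcal{D}}(\mathbf{z})=\frac1s\sum_i f((\omega^{\mathrm{ort}}_i)^\top\mathbf{z})$; MSE denotes mean squared error $\mathbb{E}[(\widehat F-F)^2]$. Class F1: $f(u)=g(|u|)$ with $g:[0,\infty)\to\mathbb{R}$ monotone. For a random variable $X$ with moment generating function $M_X(\theta)=\mathbb{E}[e^{\theta X}]$, the Legendre symbol is $\mathcal{L}_X(a)=\sup_{\theta>0}\log\frac{e^{\theta a}}{M_X(\theta)}$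 if $a>\mathbb{E}[X]$ and $\mathcal{L}_X(a)=\sup_{\theta<0}\log\frac{e^{\theta a}}{M_X(\theta)}$ if $a<\mathbb{E}[X]$. *)

theory Defs
  imports "HOL-Probability.Probability"
begin

definition isotropic :: "(real^'n) measure \<Rightarrow> bool" where
  "isotropic D \<longleftrightarrow> prob_space D \<and> sets D = sets borel \<and>
     (\<forall>Q::real^'n^'n. orthogonal_matrix Q \<longrightarrow> distr D borel (\<lambda>w. Q *v w) = D)"

definition haar_orthogonal :: "(real^'n^'n) measure \<Rightarrow> bool" where
  "haar_orthogonal H \<longleftrightarrow> prob_space H \<and> sets H = sets borel \<and>
     (AE M in H. orthogonal_matrix M) \<and>
     (\<forall>Q::real^'n^'n. orthogonal_matrix Q \<longrightarrow> distr H borel (\<lambda>M. Q ** M) = H)"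

definition F_true :: "(real^'n) measure \<Rightarrow> (real \<Rightarrow> real) \<Rightarrow> real^'n \<Rightarrow> real" where
  "F_true D f z = (\<integral>w. f (w \<bullet> z) \<partial>D)"

definition X_dist :: "(real^'n) measure \<Rightarrow> (real \<Rightarrow> real) \<Rightarrow> real^'n \<Rightarrow> real measure" where
  "X_dist D f z = distr D borel (\<lambda>w. f (w \<bullet> z))"

text \<open>Sample space of the block-orthogonal ensemble: k independent Haar matrices
  (one per block) and s i.i.d. lengths distributed as the norm of w ~ D.\<close>
definition ort_space :: "(real^'n) measure \<Rightarrow> (real^'n^'n) measure \<Rightarrow> nat \<Rightarrow> nat
    \<Rightarrow> ((nat \<Rightarrow> real^'n^'n) \<times> (nat \<Rightarrow> real)) measure" where
  "ort_space D H k s = (PiM {..<k} (\<lambda>_. H)) \<Otimes>\<^sub>M (PiM {..<s} (\<lambda>_. distr D borel norm))"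

text \<open>Sample i lies in block blk i and uses row pos i of that block's Haar matrix:
  w^ort_i = l_i * (row pos i of M_(blk i)).\<close>
definition F_ort :: "(real \<Rightarrow> real) \<Rightarrow> real^'n \<Rightarrow> (nat \<Rightarrow> nat) \<Rightarrow> (nat \<Rightarrow> 'n) \<Rightarrow> nat
    \<Rightarrow> (nat \<Rightarrow> real^'n^'n) \<times> (nat \<Rightarrow> real) \<Rightarrow> real" where
  "F_ort f z blk pos s = (\<lambda>(Ms, ls). (\<Sum>i<s. f ((ls i *\<^sub>R (Ms (blk i) $ pos i)) \<bullet> z)) / real s)"

definition iid_space :: "(real^'n) measure \<Rightarrow> nat \<Rightarrow> (nat \<Rightarrow> real^'n) measure" where
  "iid_space D s = PiM {..<s} (\<lambda>_. D)"

definition F_iid :: "(real \<Rightarrow> real) \<Rightarrow> real^'n \<Rightarrow> nat \<Rightarrow> (nat \<Rightarrow> real^'n) \<Rightarrow> real" where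
  "F_iid f z s = (\<lambda>ws. (\<Sum>i<s. f (ws i \<bullet> z)) / real s)"

definition mgf :: "real measure \<Rightarrow> real \<Rightarrow> ennreal" where
  "mgf P \<theta> = (\<integral>\<^sup>+x. ennreal (exp (\<theta> * x)) \<partial>P)"

definition legendre :: "real measure \<Rightarrow> real \<Rightarrow> ereal" where
  "legendre P a =
    (let m = (\<integral>x. x \<partial>P);
         g = (\<lambda>\<theta>. if mgf P \<theta> = \<infinity> then -\<infinity>
                   else ereal (\<theta> * a - ln (enn2real (mgf P \<theta>))))
     in if a > m then (SUP \<theta>\<in>{0<..}. g \<theta>)
        else if a < m then (SUP \<theta>\<in>{..<0}. g \<theta>)
        else 0)"

definition exp_neg :: "real \<Rightarrow> ereal \<Rightarrow> ennreal" where
  "exp_neg c L = (case L of ereal r \<Rightarrow> ennreal (exp (- c * r)) | PInfty \<Rightarrow> 0 | MInfty \<Rightarrow> \<infinity>)"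

end

theory Submission
  imports Defs
begin

text \<open>
  For a Haar matrix \<open>M\<close>, the vector \<open>y = M z\<close> is uniformly distributed on the sphere of radius
  \<open>\<bar>z\<bar>\<close>. Given one coordinate, the remaining ones are uniform on a sphere whose radius decreases in the
  modulus of that coordinate. By Chebyshev's association inequality, the expectation of a product of
  nonnegative functions of the \<open>\<bar>y\<^sub>i\<bar>\<close>, all increasing or all decreasing, is therefore at most the
  product of the expectations. Applied to \<open>exp (\<theta> f)\<close>, this bounds the moment generating function of
  the orthogonal estimator by that of the i.i.d. estimator, so Chernoff's and Hoeffding's arguments
  carry over; applied to an increasing nonnegative affine image of \<open>f\<close> at two coordinates, it makes
  the covariances of the summands nonpositive.
\<close>

section \<open>Householder reflections and Haar matrices\<close>

declare transpose_matrix_vector [simp del]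

section \<open>Measurability of vector and matrix operations\<close>

lemma measurable_vec_nth [measurable (raw)]:
  fixes f :: "'a \<Rightarrow> 'b::euclidean_space^'n"
  assumes "f \<in> borel_measurable M"
  shows "(\<lambda>x. f x $ i) \<in> borel_measurable M"
  using assms by (rule borel_measurable_continuous_on[rotated]) (intro continuous_intros)

lemma measurable_vec_lambda [measurable (raw)]:
  fixes f :: "'n::finite \<Rightarrow> 'a \<Rightarrow> 'b::euclidean_space"
  assumes "\<And>i. f i \<in> borel_measurable M"
  shows "(\<lambda>x. \<chi> i. f i x) \<in> borel_measurable M"
  unfolding borel_measurable_euclidean_space[where f = "\<lambda>x. \<chi> i. f i x"]
proof
  fix b :: "'b^'n" assume "b \<in> Basis"
  then obtain i u where b: "b = axis i u" "u \<in> Basis"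
    by (auto simp: Basis_vec_def)
  note assms[measurable]
  show "(\<lambda>x. (\<chi> i. f i x) \<bullet> b) \<in> borel_measurable M"
    by (simp add: b inner_axis)
qed

lemma measurable_matrix_vector_mult [measurable (raw)]:
  fixes A :: "'a \<Rightarrow> real^'n^'m"
  assumes [measurable]: "A \<in> borel_measurable M" "x \<in> borel_measurable M"
  shows "(\<lambda>w. A w *v x w) \<in> borel_measurable M"
  unfolding matrix_vector_mult_def by measurable

lemma measurable_matrix_matrix_mult [measurable (raw)]:
  fixes A :: "'a \<Rightarrow> real^'n^'m" and B :: "'a \<Rightarrow> real^'k^'n"
  assumes [measurable]: "A \<in> borel_measurable M" "B \<in> borel_measurable M"
  shows "(\<lambda>w. A w ** B w) \<in> borel_measurable M"
  unfolding matrix_matrix_mult_def by measurable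

lemma measurable_transpose [measurable (raw)]:
  fixes A :: "'a \<Rightarrow> real^'n^'m"
  assumes [measurable]: "A \<in> borel_measurable M"
  shows "(\<lambda>w. transpose (A w)) \<in> borel_measurable M"
  unfolding transpose_def by measurable

section \<open>Householder reflections\<close>

definition householder :: "real^'n \<Rightarrow> real^'n^'n" where
  "householder u = (\<chi> i j. (if i = j then 1 else 0) - 2 / (u \<bullet> u) * (u $ i * u $ j))"

lemma measurable_householder [measurable (raw)]:
  assumes [measurable]: "u \<in> borel_measurable M"
  shows "(\<lambda>w. householder (u w)) \<in> borel_measurable M"
  unfolding householder_def by measurable

lemma householder_mult: "householder u *v x = x - (2 * (u \<bullet> x) / (u \<bullet> u)) *\<^sub>R u"
proof (simp add: vec_eq_iff, intro allI)
  fix i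
  have "(householder u *v x) $ i = (\<Sum>j\<in>UNIV. (if i = j then x $ j else 0) - 2 / (u \<bullet> u) * u $ i * (u $ j * x $ j))"
    by (auto simp: householder_def matrix_vector_mult_def algebra_simps intro!: sum.cong)
  also have "\<dots> = x $ i - 2 / (u \<bullet> u) * u $ i * (u \<bullet> x)"
    by (simp only: sum_subtractf sum_distrib_left[symmetric] inner_vec_def[of u x]) simp
  finally show "(householder u *v x) $ i = x $ i - 2 * (u \<bullet> x) * u $ i / (u \<bullet> u)"
    by simp
qed

lemma transpose_householder: "transpose (householder u) = householder u"
  by (auto simp: transpose_def householder_def vec_eq_iff)

lemma orthogonal_householder: "orthogonal_matrix (householder u)"
proof -
  have "(householder u ** householder u) *v x = mat 1 *v x" for x
    \<comment> \<open>The cancellation of \<open>u \<bullet> u\<close> needs a nonzero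
      \<open>u\<close>. At \<open>u = 0\<close> the quotient \<open>2 / 0\<close> is 0 and the
      matrix is the identity, which is orthogonal as well.\<close>
    by (cases "u = 0")
      (simp_all add: matrix_vector_mul_assoc[symmetric] householder_mult inner_diff_right)
  then show ?thesis
    unfolding orthogonal_matrix transpose_householder by (simp add: matrix_eq)
qed

text \<open>Equality of the norms turns \<open>2 * ((a - b) \<bullet> a)\<close> into the squared
  length of \<open>a - b\<close>, so exactly one copy of \<open>a - b\<close> is subtracted from
  \<open>a\<close>. This gives transitivity of the orthogonal group on spheres with an explicit
  witness that is measurable in \<open>a\<close> and \<open>b\<close>; for \<open>a = b\<close> the
  witness is the identity.\<close>

lemma householder_swap:
  assumes "norm a = norm b"
  shows "householder (a - b) *v a = b"
proof (cases "a = b")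
  case False
  have "2 * ((a - b) \<bullet> a) = (a - b) \<bullet> (a - b)"
    using assms by (simp add: norm_eq inner_diff_left inner_diff_right inner_commute)
  then show ?thesis
    using False by (simp add: householder_mult)
qed (simp add: householder_mult)

lemma householder_fix: "u \<bullet> x = 0 \<Longrightarrow> householder u *v x = x"
  by (simp add: householder_mult)

lemma orthogonal_matrix_mult_norm:
  "orthogonal_matrix (Q::real^'n^'n) \<Longrightarrow> norm (Q *v x) = norm x"
  by (simp add: norm_eq_sqrt_inner dot_lmul_matrix[symmetric] transpose_matrix_vector[symmetric]
      matrix_vector_mul_assoc orthogonal_matrix)

lemma matrix_vector_inner_transpose:
  fixes A :: "real^'n^'m"
  shows "(A *v x) \<bullet> y = x \<bullet> (transpose A *v y)"
  by (metis dot_lmul_matrix transpose_matrix_vector transpose_transpose)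

section \<open>Integrals under Haar and isotropic invariance\<close>

lemma haar_nn_integral:
  assumes "haar_orthogonal H" "orthogonal_matrix Q" and [measurable]: "F \<in> borel_measurable borel"
  shows "(\<integral>\<^sup>+M. F (Q ** M) \<partial>H) = (\<integral>\<^sup>+M. F M \<partial>H)"
proof -
  have [measurable_cong]: "sets H = sets borel" and eq: "distr H borel (\<lambda>M. Q ** M) = H"
    using assms by (auto simp: haar_orthogonal_def)
  have "(\<integral>\<^sup>+M. F M \<partial>distr H borel (\<lambda>M. Q ** M)) = (\<integral>\<^sup>+M. F (Q ** M) \<partial>H)"
    by (subst nn_integral_distr) measurable
  then show ?thesis by (simp add: eq)
qed

lemma isotropic_nn_integral:
  assumes "isotropic D" "orthogonal_matrix Q" and [measurable]: "F \<in> borel_measurable borel"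
  shows "(\<integral>\<^sup>+w. F (Q *v w) \<partial>D) = (\<integral>\<^sup>+w. F w \<partial>D)"
proof -
  have [measurable_cong]: "sets D = sets borel" and eq: "distr D borel (\<lambda>w. Q *v w) = D"
    using assms by (auto simp: isotropic_def)
  have "(\<integral>\<^sup>+w. F w \<partial>distr D borel (\<lambda>w. Q *v w)) = (\<integral>\<^sup>+w. F (Q *v w) \<partial>D)"
    by (subst nn_integral_distr) measurable
  then show ?thesis by (simp add: eq)
qed

text \<open>Isotropy rotates \<open>z\<close> by a Haar matrix without changing the left side. For a
  fixed \<open>w\<close>, left invariance of \<open>H\<close> then turns \<open>w\<close> into a
  multiple of the axis \<open>p\<close>. Hence a length times one coordinate of
  \<open>M *v z\<close> has the law of \<open>w \<bullet> z\<close>.\<close>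

lemma isotropic_marginal:
  fixes D :: "(real^'n) measure" and H :: "(real^'n^'n) measure"
  assumes iso: "isotropic D" and haar: "haar_orthogonal H"
    and h [measurable]: "h \<in> borel_measurable borel"
  shows "(\<integral>\<^sup>+w. h (w \<bullet> z) \<partial>D) = (\<integral>\<^sup>+w. \<integral>\<^sup>+M. h (norm w * (M *v z) $ p) \<partial>H \<partial>D)"
proof -
  have [measurable_cong]: "sets D = sets borel" "sets H = sets borel"
    and AE: "AE M in H. orthogonal_matrix M"
    using assms by (auto simp: haar_orthogonal_def isotropic_def)
  interpret D: prob_space D using iso by (simp add: isotropic_def)
  interpret H: prob_space H using haar by (simp add: haar_orthogonal_def)
  interpret P: pair_prob_space D H ..
  \<comment> \<open>The constant average over \<open>M\<close> is introduced so that isotropy can be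
    used with a different matrix for each \<open>M\<close>.\<close>
  have "(\<integral>\<^sup>+w. h (w \<bullet> z) \<partial>D) = (\<integral>\<^sup>+M. \<integral>\<^sup>+w. h (w \<bullet> z) \<partial>D \<partial>H)"
    by (simp add: H.emeasure_space_1)
  also have "\<dots> = (\<integral>\<^sup>+M. \<integral>\<^sup>+w. h (w \<bullet> (M *v z)) \<partial>D \<partial>H)"
  proof (rule nn_integral_cong_AE, use AE in eventually_elim)
    fix M :: "real^'n^'n" assume M: "orthogonal_matrix M"
    have "(\<integral>\<^sup>+w. h (w \<bullet> z) \<partial>D) = (\<integral>\<^sup>+w. h ((transpose M *v w) \<bullet> z) \<partial>D)"
      by (rule isotropic_nn_integral[OF iso, symmetric]) (use M in simp_all)
    then show "(\<integral>\<^sup>+w. h (w \<bullet> z) \<partial>D) = (\<integral>\<^sup>+w. h (w \<bullet> (M *v z)) \<partial>D)"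
      using M by (simp add: matrix_vector_inner_transpose)
  qed
  also have "\<dots> = (\<integral>\<^sup>+w. \<integral>\<^sup>+M. h (w \<bullet> (M *v z)) \<partial>H \<partial>D)"
    by (rule P.Fubini') measurable
  also have "\<dots> = (\<integral>\<^sup>+w. \<integral>\<^sup>+M. h (norm w * (M *v z) $ p) \<partial>H \<partial>D)"
  proof (rule nn_integral_cong)
    fix w :: "real^'n"
    let ?a = "norm w *\<^sub>R axis p (1::real)"
    \<comment> \<open>This reflection carries \<open>w\<close> to \<open>?a\<close>; replacing
      \<open>M\<close> by \<open>Q ** M\<close> is free under \<open>H\<close>.\<close>
    define Q where "Q = householder (w - ?a)"
    have Q: "orthogonal_matrix Q" "transpose Q = Q" "Q *v w = ?a"
      by (auto simp: Q_def orthogonal_householder transpose_householder intro!: householder_swap)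
    have eq: "norm w * ((Q ** M) *v z) $ p = w \<bullet> (M *v z)" for M
    proof -
      have "norm w * ((Q ** M) *v z) $ p = ?a \<bullet> (Q *v (M *v z))"
        by (simp add: inner_axis' matrix_vector_mul_assoc)
      also have "\<dots> = w \<bullet> (M *v z)"
        using Q matrix_vector_inner_transpose[of Q w "Q *v (M *v z)"]
        by (simp add: matrix_vector_mul_assoc orthogonal_matrix matrix_mul_assoc)
      finally show ?thesis .
    qed
    have "(\<integral>\<^sup>+M. h (norm w * ((Q ** M) *v z) $ p) \<partial>H) = (\<integral>\<^sup>+M. h (norm w * (M *v z) $ p) \<partial>H)"
      by (rule haar_nn_integral[OF haar Q(1)]) measurable
    then show "(\<integral>\<^sup>+M. h (w \<bullet> (M *v z)) \<partial>H) = (\<integral>\<^sup>+M. h (norm w * (M *v z) $ p) \<partial>H)"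
      by (simp add: eq)
  qed
  finally show ?thesis .
qed

text \<open>\<open>U\<close> is the image of \<open>e\<^sub>q\<close> under a random element \<open>L\<close> of the stabiliser of \<open>e\<^sub>p\<close>. The Householder
  reflection that brings \<open>M\<^sup>T\<close> into the stabiliser depends only on \<open>M\<^sup>T e\<^sub>p\<close>, so \<open>L\<close> inherits right
  invariance from the Haar measure of the full group, and none on a smaller group is needed.\<close>

lemma haar_resample_complement:
  fixes H :: "(real^'n^'n) measure"
  assumes haar: "haar_orthogonal H" and "p \<noteq> q"
  obtains U :: "real^'n^'n \<Rightarrow> real^'n" where "U \<in> borel_measurable borel" "AE N in H. U N $ p = 0"
    "\<And>F z. F \<in> borel_measurable borel \<Longrightarrow> (\<integral>\<^sup>+M. F (M *v z) \<partial>H) =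
      (\<integral>\<^sup>+M. \<integral>\<^sup>+N. F ((M *v z) $ p *\<^sub>R axis p 1 +
        norm (M *v z - (M *v z) $ p *\<^sub>R axis p 1) *\<^sub>R U N) \<partial>H \<partial>H)"
proof -
  define e where "e = (\<lambda>i::'n. axis i (1::real))"
  define L where "L = (\<lambda>M. householder (transpose M *v e p - e p) ** transpose M)"
  have [measurable_cong]: "sets H = sets borel"
    and AE: "AE M in H. orthogonal_matrix M"
    using haar by (auto simp: haar_orthogonal_def)
  interpret H: prob_space H using haar by (simp add: haar_orthogonal_def)
  interpret P: pair_prob_space H H ..
  have [measurable]: "L \<in> borel_measurable borel"
    unfolding L_def by measurable
  have L: "orthogonal_matrix (L M)" "L M *v e p = e p" if "orthogonal_matrix M" for M
  proof -
    show "orthogonal_matrix (L M)"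
      using that by (simp add: L_def orthogonal_matrix_mul orthogonal_householder)
    have "norm (transpose M *v e p) = norm (e p)"
      using that by (simp add: orthogonal_matrix_mult_norm)
    then show "L M *v e p = e p"
      unfolding L_def matrix_vector_mul_assoc[symmetric] by (rule householder_swap)
  qed
  show thesis
  proof (rule that[of "\<lambda>N. L N *v e q"])
    show "(\<lambda>N. L N *v e q) \<in> borel_measurable borel"
      by measurable
    show "AE N in H. (L N *v e q) $ p = 0"
      using AE
    proof eventually_elim
      fix N :: "real^'n^'n" assume N: "orthogonal_matrix N"
      have "(L N *v e q) \<bullet> e p = (L N *v e q) \<bullet> (L N *v e p)"
        using L[OF N] by simp
      also have "\<dots> = e q \<bullet> e p"
        using L(1)[OF N] by (simp add: matrix_vector_inner_transpose matrix_vector_mul_assoc orthogonal_matrix)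
      finally show "(L N *v e q) $ p = 0"
        using \<open>p \<noteq> q\<close> by (simp add: e_def inner_axis) (simp add: axis_def)
    qed
    fix F :: "real^'n \<Rightarrow> ennreal" and z :: "real^'n"
    assume F [measurable]: "F \<in> borel_measurable borel"
    \<comment> \<open>Averaging over an independent dummy \<open>N\<close> allows left invariance in
      \<open>M\<close> to be used with the matrix \<open>L N\<close>, which is constant for each
      \<open>N\<close>.\<close>
    have "(\<integral>\<^sup>+M. F (M *v z) \<partial>H) = (\<integral>\<^sup>+N. \<integral>\<^sup>+M. F (M *v z) \<partial>H \<partial>H)"
      by (simp add: H.emeasure_space_1)
    also have "\<dots> = (\<integral>\<^sup>+N. \<integral>\<^sup>+M. F (L N *v (M *v z)) \<partial>H \<partial>H)"
    proof (rule nn_integral_cong_AE, use AE in eventually_elim)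
      fix N :: "real^'n^'n" assume "orthogonal_matrix N"
      then have "(\<integral>\<^sup>+M. F ((L N ** M) *v z) \<partial>H) = (\<integral>\<^sup>+M. F (M *v z) \<partial>H)"
        by (intro haar_nn_integral[OF haar] L) measurable
      then show "(\<integral>\<^sup>+M. F (M *v z) \<partial>H) = (\<integral>\<^sup>+M. F (L N *v (M *v z)) \<partial>H)"
        by (simp add: matrix_vector_mul_assoc)
    qed
    also have "\<dots> = (\<integral>\<^sup>+M. \<integral>\<^sup>+N. F (L N *v (M *v z)) \<partial>H \<partial>H)"
      by (rule P.Fubini') measurable
    also have "\<dots> = (\<integral>\<^sup>+M. \<integral>\<^sup>+N. F ((M *v z) $ p *\<^sub>R e p +
          norm (M *v z - (M *v z) $ p *\<^sub>R e p) *\<^sub>R (L N *v e q)) \<partial>H \<partial>H)"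
    proof (rule nn_integral_cong)
      fix M :: "real^'n^'n"
      define y where "y = M *v z"
      define v where "v = y - y $ p *\<^sub>R e p"
      \<comment> \<open>This reflection fixes \<open>e p\<close> and exchanges
        \<open>norm v *\<^sub>R e q\<close> with \<open>v\<close>. It moves \<open>y\<close> into
        the plane of \<open>e p\<close> and \<open>e q\<close>, keeping its coordinate
        \<open>p\<close> and its length, so only these two numbers of \<open>y\<close>
        survive.\<close>
      define Q where "Q = householder (norm v *\<^sub>R e q - v)"
      have v: "v \<bullet> e p = 0"
        by (simp add: v_def e_def inner_diff_left inner_axis inner_axis')
      have "(norm v *\<^sub>R e q - v) \<bullet> e p = 0"
        using \<open>p \<noteq> q\<close> v by (simp add: inner_diff_left) (simp add: e_def inner_axis_axis)
      then have Q: "orthogonal_matrix Q" "transpose Q = Q" "Q *v e p = e p"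
          "Q *v (norm v *\<^sub>R e q) = v"
        by (auto simp: Q_def orthogonal_householder transpose_householder e_def
            intro!: householder_swap householder_fix)
      have y: "y = Q *v (y $ p *\<^sub>R e p + norm v *\<^sub>R e q)"
        using Q(3,4) by (simp add: matrix_vector_right_distrib matrix_vector_mult_scaleR v_def)
      \<comment> \<open>Transposing \<open>Q ** N\<close> puts \<open>Q\<close> on the right of
        \<open>transpose N\<close>. As \<open>Q\<close> fixes \<open>e p\<close>, the image of
        \<open>e p\<close> and thus the reflection inside \<open>L\<close> stay the same.\<close>
      have LQ: "L (Q ** N) = L N ** Q" for N
        using Q by (simp add: L_def matrix_transpose_mul matrix_mul_assoc
            matrix_vector_mul_assoc[symmetric])
      have "(\<integral>\<^sup>+N. F (L N *v y) \<partial>H) =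
          (\<integral>\<^sup>+N. F (L (Q ** N) *v (y $ p *\<^sub>R e p + norm v *\<^sub>R e q)) \<partial>H)"
        by (subst y) (simp only: LQ matrix_vector_mul_assoc)
      also have "\<dots> = (\<integral>\<^sup>+N. F (L N *v (y $ p *\<^sub>R e p + norm v *\<^sub>R e q)) \<partial>H)"
        by (rule haar_nn_integral[OF haar Q(1)]) measurable
      also have "\<dots> = (\<integral>\<^sup>+N. F (y $ p *\<^sub>R e p + norm v *\<^sub>R (L N *v e q)) \<partial>H)"
        by (rule nn_integral_cong_AE, use AE in eventually_elim)
          (simp add: matrix_vector_right_distrib matrix_vector_mult_scaleR L)
      finally show "(\<integral>\<^sup>+N. F (L N *v (M *v z)) \<partial>H) = (\<integral>\<^sup>+N. F ((M *v z) $ p *\<^sub>R e p +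
          norm (M *v z - (M *v z) $ p *\<^sub>R e p) *\<^sub>R (L N *v e q)) \<partial>H)"
        by (simp add: y_def v_def)
    qed
    finally show "(\<integral>\<^sup>+M. F (M *v z) \<partial>H) = (\<integral>\<^sup>+M. \<integral>\<^sup>+N. F ((M *v z) $ p *\<^sub>R axis p 1 +
        norm (M *v z - (M *v z) $ p *\<^sub>R axis p 1) *\<^sub>R (L N *v e q)) \<partial>H \<partial>H)"
      by (simp add: e_def)
  qed
qed

section \<open>Negative dependence of the coordinates\<close>

text \<open>For two independent points the rearrangement inequality holds pointwise; integrating it
  over both points gives twice each side. The predicate \<open>P\<close> allows the opposite
  ordering to be checked only almost everywhere.\<close>

lemma (in prob_space) nn_integral_chebyshev:
  fixes a b :: "'a \<Rightarrow> ennreal"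
  assumes [measurable]: "a \<in> borel_measurable M" "b \<in> borel_measurable M"
    and AE: "AE x in M. P x"
    and opp: "\<And>x y. P x \<Longrightarrow> P y \<Longrightarrow> (a x \<le> a y \<and> b y \<le> b x) \<or> (a y \<le> a x \<and> b x \<le> b y)"
  shows "(\<integral>\<^sup>+x. a x * b x \<partial>M) \<le> (\<integral>\<^sup>+x. a x \<partial>M) * (\<integral>\<^sup>+x. b x \<partial>M)"
proof -
  have le: "a1 * b1 + a2 * b2 \<le> a1 * b2 + a2 * b1"
    if "a1 \<le> a2" "b2 \<le> b1" for a1 a2 b1 b2 :: ennreal
  proof -
    \<comment> \<open>Naming the increments avoids truncated subtraction: the two sides then differ
      by the nonnegative term \<open>u * v\<close>.\<close>
    obtain u v where uv: "a2 = a1 + u" "b1 = b2 + v"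
      using \<open>a1 \<le> a2\<close> \<open>b2 \<le> b1\<close> by (auto simp: le_iff_add)
    have "a1 * b2 + a2 * b1 = a1 * b1 + a2 * b2 + u * v"
      by (simp add: uv algebra_simps)
    then show ?thesis by simp
  qed
  have "2 * (\<integral>\<^sup>+x. a x * b x \<partial>M) = (\<integral>\<^sup>+x. \<integral>\<^sup>+y. a x * b x + a y * b y \<partial>M \<partial>M)"
    by (simp add: nn_integral_add emeasure_space_1 mult_2)
  also have "\<dots> \<le> (\<integral>\<^sup>+x. \<integral>\<^sup>+y. a x * b y + a y * b x \<partial>M \<partial>M)"
  proof (rule nn_integral_mono_AE, use AE in eventually_elim)
    fix x assume x: "P x"
    show "(\<integral>\<^sup>+y. a x * b x + a y * b y \<partial>M) \<le> (\<integral>\<^sup>+y. a x * b y + a y * b x \<partial>M)"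
    proof (rule nn_integral_mono_AE, use AE in eventually_elim)
      fix y assume y: "P y"
      from opp[OF x y] show "a x * b x + a y * b y \<le> a x * b y + a y * b x"
        using le[of "a x" "a y" "b y" "b x"] le[of "a y" "a x" "b x" "b y"]
        by (auto simp: add.commute)
    qed
  qed
  also have "\<dots> = 2 * ((\<integral>\<^sup>+x. a x \<partial>M) * (\<integral>\<^sup>+x. b x \<partial>M))"
    by (simp add: nn_integral_add nn_integral_cmult nn_integral_multc mult_2)
  finally show ?thesis
    by (simp add: ennreal_mult_le_mult_iff)
qed

lemma norm_remove_component:
  fixes y :: "real^'n"
  shows "norm (y - y $ p *\<^sub>R axis p 1) = sqrt ((norm y)\<^sup>2 - (y $ p)\<^sup>2)"
  by (simp add: norm_eq_sqrt_inner inner_diff_left inner_diff_right inner_axis inner_axis'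
      power2_eq_square)

text \<open>Induction that splits off one coordinate at a time and applies Chebyshev's inequality to
  it and the conditional expectation of the rest. The relation \<open>R\<close> fixes one common
  direction for all factors, so that the increasing and the decreasing case share a proof.\<close>

lemma haar_negative_orthant_dependence:
  fixes H :: "(real^'n^'n) measure" and h :: "'i \<Rightarrow> real \<Rightarrow> ennreal"
  assumes haar: "haar_orthogonal H"
    and "finite I" "inj_on pos I"
    and h: "\<And>i. i \<in> I \<Longrightarrow> h i \<in> borel_measurable borel"
    and R: "R = (\<le>) \<or> R = (\<ge>)"
    and mono: "\<And>i. i \<in> I \<Longrightarrow> monotone_on {0..} (\<le>) R (h i)"
  shows "(\<integral>\<^sup>+M. (\<Prod>i\<in>I. h i \<bar>(M *v z) $ pos i\<bar>) \<partial>H) \<le> (\<Prod>i\<in>I. \<integral>\<^sup>+M. h i \<bar>(M *v z) $ pos i\<bar> \<partial>H)"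
  using assms(2-4) mono
proof (induction I rule: finite_induct)
  case empty
  show ?case
    using haar by (simp add: haar_orthogonal_def prob_space.emeasure_space_1)
next
  case (insert i I)
  have [measurable_cong]: "sets H = sets borel"
    and AE: "AE M in H. orthogonal_matrix M"
    using haar by (auto simp: haar_orthogonal_def)
  interpret H: prob_space H using haar by (simp add: haar_orthogonal_def)
  have hI [measurable]: "h j \<in> borel_measurable borel" if "j \<in> insert i I" for j
    using insert.prems that by auto
  define p where "p = pos i"
  have IH: "(\<integral>\<^sup>+M. (\<Prod>i\<in>I. h i \<bar>(M *v z) $ pos i\<bar>) \<partial>H) \<le> (\<Prod>i\<in>I. \<integral>\<^sup>+M. h i \<bar>(M *v z) $ pos i\<bar> \<partial>H)"
    using insert by auto
  have split: "(\<integral>\<^sup>+M. h i \<bar>(M *v z) $ p\<bar> * (\<Prod>j\<in>I. h j \<bar>(M *v z) $ pos j\<bar>) \<partial>H)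
    \<le> (\<integral>\<^sup>+M. h i \<bar>(M *v z) $ p\<bar> \<partial>H) * (\<integral>\<^sup>+M. (\<Prod>j\<in>I. h j \<bar>(M *v z) $ pos j\<bar>) \<partial>H)"
  \<comment> \<open>Resampling needs a coordinate other than \<open>p\<close>, which a nonempty
    \<open>I\<close> supplies. For empty \<open>I\<close> the product is 1.\<close>
  proof (cases "I = {}")
    case False
    then obtain j where "j \<in> I" by auto
    have ne: "pos j \<noteq> p" if "j \<in> I" for j
      using that insert by (auto simp: p_def inj_on_def)
    obtain U where U [measurable]: "U \<in> borel_measurable borel" and Up: "AE N in H. U N $ p = 0"
      and resample: "\<And>F z. F \<in> borel_measurable borel \<Longrightarrow> (\<integral>\<^sup>+M. F (M *v z) \<partial>H) =
      (\<integral>\<^sup>+M. \<integral>\<^sup>+N. F ((M *v z) $ p *\<^sub>R axis p 1 +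
        norm (M *v z - (M *v z) $ p *\<^sub>R axis p 1) *\<^sub>R U N) \<partial>H \<partial>H)"
      using haar_resample_complement[OF haar ne[OF \<open>j \<in> I\<close>, symmetric]] by blast
    \<comment> \<open>The conditional expectation of the remaining product, given that the part of
      \<open>M *v z\<close> orthogonal to axis \<open>p\<close> has length \<open>r\<close>.\<close>
    define \<phi> where "\<phi> r = (\<integral>\<^sup>+N. (\<Prod>j\<in>I. h j \<bar>r * U N $ pos j\<bar>) \<partial>H)" for r
    define \<rho> where "\<rho> M = norm (M *v z - (M *v z) $ p *\<^sub>R axis p 1)" for M :: "real^'n^'n"
    have [measurable]: "\<phi> \<in> borel_measurable borel" "\<rho> \<in> borel_measurable borel"
      unfolding \<phi>_def \<rho>_def by measurable
    \<comment> \<open>The weight \<open>k\<close> stays free: \<open>k = h i\<close> gives the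
      product over all coordinates, \<open>k = 1\<close> the product over \<open>I\<close>
      alone.\<close>
    have rep: "(\<integral>\<^sup>+M. k \<bar>(M *v z) $ p\<bar> * (\<Prod>j\<in>I. h j \<bar>(M *v z) $ pos j\<bar>) \<partial>H)
        = (\<integral>\<^sup>+M. k \<bar>(M *v z) $ p\<bar> * \<phi> (\<rho> M) \<partial>H)"
      if [measurable]: "k \<in> borel_measurable borel" for k :: "real \<Rightarrow> ennreal"
    proof -
      let ?F = "\<lambda>y. k \<bar>y $ p\<bar> * (\<Prod>j\<in>I. h j \<bar>y $ pos j\<bar>)"
      have "(\<integral>\<^sup>+M. ?F (M *v z) \<partial>H) =
          (\<integral>\<^sup>+M. \<integral>\<^sup>+N. ?F ((M *v z) $ p *\<^sub>R axis p 1 + \<rho> M *\<^sub>R U N) \<partial>H \<partial>H)"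
        unfolding \<rho>_def by (rule resample) measurable
      also have "\<dots> = (\<integral>\<^sup>+M. \<integral>\<^sup>+N. k \<bar>(M *v z) $ p\<bar> * (\<Prod>j\<in>I. h j \<bar>\<rho> M * U N $ pos j\<bar>) \<partial>H \<partial>H)"
        \<comment> \<open>Almost surely \<open>U N\<close> has no component along \<open>p\<close>,
          so coordinate \<open>p\<close> survives the resampling, while the axis term vanishes at
          every other coordinate.\<close>
        by (rule nn_integral_cong, rule nn_integral_cong_AE, use Up in eventually_elim)
          (auto simp: axis_def ne intro!: arg_cong2[where f = "(*)"] prod.cong)
      also have "\<dots> = (\<integral>\<^sup>+M. k \<bar>(M *v z) $ p\<bar> * \<phi> (\<rho> M) \<partial>H)"
        unfolding \<phi>_def by (intro nn_integral_cong nn_integral_cmult) measurable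
      finally show ?thesis .
    qed
    have \<phi>_mono: "R (\<phi> r) (\<phi> r')" if "0 \<le> r" "r \<le> r'" for r r'
    proof -
      have "R (h j \<bar>r * u\<bar>) (h j \<bar>r' * u\<bar>)" if "j \<in> I" for j u
        unfolding abs_mult
        using insert.prems(3)[of j] that \<open>0 \<le> r\<close> \<open>r \<le> r'\<close>
        by (intro monotone_onD[where f = "h j" and orda = "(\<le>)" and ordb = R and A = "{0..}"])
          (auto intro: mult_right_mono)
      then show ?thesis
        using R unfolding \<phi>_def by (auto intro!: nn_integral_mono prod_mono_ennreal)
    qed
    have \<rho>_eq: "\<rho> M = sqrt ((norm z)\<^sup>2 - \<bar>(M *v z) $ p\<bar>\<^sup>2)" if "orthogonal_matrix M" for M
      using that by (simp add: \<rho>_def norm_remove_component orthogonal_matrix_mult_norm)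
    have "(\<integral>\<^sup>+M. h i \<bar>(M *v z) $ p\<bar> * \<phi> (\<rho> M) \<partial>H)
        \<le> (\<integral>\<^sup>+M. h i \<bar>(M *v z) $ p\<bar> \<partial>H) * (\<integral>\<^sup>+M. \<phi> (\<rho> M) \<partial>H)"
    proof (rule H.nn_integral_chebyshev[OF _ _ AE])
      fix M N :: "real^'n^'n" assume MN: "orthogonal_matrix M" "orthogonal_matrix N"
      have *: "R (h i \<bar>(M *v z) $ p\<bar>) (h i \<bar>(N *v z) $ p\<bar>) \<and> R (\<phi> (\<rho> N)) (\<phi> (\<rho> M))"
        if MN: "orthogonal_matrix M" "orthogonal_matrix N"
          and le: "\<bar>(M *v z) $ p\<bar> \<le> \<bar>(N *v z) $ p\<bar>" for M N
      proof
        show "R (h i \<bar>(M *v z) $ p\<bar>) (h i \<bar>(N *v z) $ p\<bar>)"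
          using insert.prems(3)[of i] le by (auto simp: monotone_on_def)
        \<comment> \<open>The total length \<open>norm z\<close> is fixed, so a larger coordinate
          \<open>p\<close> leaves a shorter remainder; this is where the opposite ordering comes
          from.\<close>
        have "\<rho> N \<le> \<rho> M"
          unfolding \<rho>_eq[OF MN(1)] \<rho>_eq[OF MN(2)]
          using power_mono[OF le, of 2] by simp
        then show "R (\<phi> (\<rho> N)) (\<phi> (\<rho> M))"
          by (intro \<phi>_mono) (simp add: \<rho>_def)
      qed
      show "(h i \<bar>(M *v z) $ p\<bar> \<le> h i \<bar>(N *v z) $ p\<bar> \<and> \<phi> (\<rho> N) \<le> \<phi> (\<rho> M)) \<or>
          (h i \<bar>(N *v z) $ p\<bar> \<le> h i \<bar>(M *v z) $ p\<bar> \<and> \<phi> (\<rho> M) \<le> \<phi> (\<rho> N))"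
        using *[OF MN] *[OF MN(2,1)] R linear[of "\<bar>(M *v z) $ p\<bar>" "\<bar>(N *v z) $ p\<bar>"] by auto
    qed measurable
    then show ?thesis
      using rep[of "h i"] rep[of "\<lambda>_. 1"] by simp
  qed (simp add: H.emeasure_space_1)
  show ?case
    using insert.hyps order_trans[OF split mult_left_mono[OF IH zero_le]] by (simp add: p_def)
qed

section \<open>The block-orthogonal ensemble\<close>

text \<open>Written through a coordinate of \<open>M *v z\<close> instead of a row of
  \<open>M\<close>, so that the dependence results on the coordinates of a uniform point of a sphere
  apply directly.\<close>

definition ort_proj :: "real^'n \<Rightarrow> (nat \<Rightarrow> nat) \<Rightarrow> (nat \<Rightarrow> 'n) \<Rightarrow> nat
    \<Rightarrow> (nat \<Rightarrow> real^'n^'n) \<times> (nat \<Rightarrow> real) \<Rightarrow> real" where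
  "ort_proj z blk pos i = (\<lambda>x. snd x i * (fst x (blk i) *v z) $ pos i)"

lemma F_ort_eq: "F_ort f z blk pos s x = (\<Sum>i<s. f (ort_proj z blk pos i x)) / real s"
  by (simp add: F_ort_def ort_proj_def case_prod_beta matrix_vector_mul_component)

text \<open>The partition into blocks is encoded by \<open>blk\<close> and \<open>pos\<close>.
  Injectivity of the pairs says that no row of a Haar matrix is used twice, which also bounds each
  block by the dimension.\<close>

locale orthogonal_ensemble =
  fixes D :: "(real^'n) measure" and H :: "(real^'n^'n) measure"
    and s k :: nat and blk :: "nat \<Rightarrow> nat" and pos :: "nat \<Rightarrow> 'n" and z :: "real^'n"
  assumes iso: "isotropic D" and haar: "haar_orthogonal H"
    and blk: "\<And>i. i < s \<Longrightarrow> blk i < k"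
    and inj: "inj_on (\<lambda>i. (blk i, pos i)) {..<s}"
begin

lemma sets_DH [measurable_cong]: "sets D = sets borel" "sets H = sets borel"
  using iso haar by (auto simp: haar_orthogonal_def isotropic_def)

lemma prob_space_DH: "prob_space D" "prob_space H"
  using iso haar by (auto simp: haar_orthogonal_def isotropic_def)

lemma prob_space_norm: "prob_space (distr D borel norm)"
  using prob_space_DH(1) by (rule prob_space.prob_space_distr) measurable

lemma prob_space_ort_space: "prob_space (ort_space D H k s)"
proof -
  interpret A: prob_space "PiM {..<k} (\<lambda>_. H)"
    by (intro prob_space_PiM prob_space_DH)
  interpret B: prob_space "PiM {..<s} (\<lambda>_. distr D borel norm)"
    by (intro prob_space_PiM prob_space_norm)
  interpret pair_prob_space "PiM {..<k} (\<lambda>_. H)" "PiM {..<s} (\<lambda>_. distr D borel norm)" ..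
  show ?thesis
    unfolding ort_space_def by unfold_locales
qed

lemma measurable_ort_proj [measurable]:
  assumes i: "i < s"
  shows "ort_proj z blk pos i \<in> borel_measurable (ort_space D H k s)"
proof -
  have [measurable]: "blk i \<in> {..<k}" "i \<in> {..<s}"
    using blk[OF i] i by auto
  show ?thesis
    unfolding ort_proj_def ort_space_def by measurable
qed

text \<open>With the matrices integrated first, the lengths act as constants in the inner
  integral.\<close>

lemma nn_integral_ort_space:
  assumes "F \<in> borel_measurable (ort_space D H k s)"
  shows "(\<integral>\<^sup>+x. F x \<partial>ort_space D H k s) =
    (\<integral>\<^sup>+ls. \<integral>\<^sup>+Ms. F (Ms, ls) \<partial>PiM {..<k} (\<lambda>_. H) \<partial>PiM {..<s} (\<lambda>_. distr D borel norm))"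
proof -
  interpret A: prob_space "PiM {..<k} (\<lambda>_. H)"
    by (intro prob_space_PiM prob_space_DH)
  interpret B: prob_space "PiM {..<s} (\<lambda>_. distr D borel norm)"
    by (intro prob_space_PiM prob_space_norm)
  interpret pair_prob_space "PiM {..<k} (\<lambda>_. H)" "PiM {..<s} (\<lambda>_. distr D borel norm)" ..
  show ?thesis
    using nn_integral_snd[of F] assms by (simp add: ort_space_def)
qed

text \<open>Only one matrix and one length enter a single sample, so the product measures reduce to
  \<open>H\<close> and the law of the norm, and \<open>isotropic_marginal\<close> applies.
  Unbiasedness and equality of the second moments rest on this, whatever the dependence between
  samples.\<close>

lemma distr_ort_proj:
  assumes i: "i < s"
  shows "distr (ort_space D H k s) borel (ort_proj z blk pos i) = distr D borel (\<lambda>w. w \<bullet> z)"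
proof (rule measure_eqI)
  fix A assume "A \<in> sets (distr (ort_space D H k s) borel (ort_proj z blk pos i))"
  then have A [measurable]: "A \<in> sets borel" by simp
  note i [simp]
  interpret H: prob_space H by (rule prob_space_DH)
  let ?L = "distr D borel norm"
  have "emeasure (distr (ort_space D H k s) borel (ort_proj z blk pos i)) A =
      (\<integral>\<^sup>+x. indicator A (ort_proj z blk pos i x) \<partial>ort_space D H k s)"
    by (subst nn_integral_indicator[symmetric], simp, subst nn_integral_distr) measurable
  also have "\<dots> = (\<integral>\<^sup>+ls. \<integral>\<^sup>+Ms. indicator A (ls i * (Ms (blk i) *v z) $ pos i)
      \<partial>PiM {..<k} (\<lambda>_. H) \<partial>PiM {..<s} (\<lambda>_. ?L))"
    by (subst nn_integral_ort_space, measurable) (simp_all add: ort_proj_def)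
  also have "\<dots> = (\<integral>\<^sup>+ls. \<integral>\<^sup>+M. indicator A (ls i * (M *v z) $ pos i) \<partial>H \<partial>PiM {..<s} (\<lambda>_. ?L))"
  proof (rule nn_integral_cong)
    fix ls
    have "(\<integral>\<^sup>+M. indicator A (ls i * (M *v z) $ pos i)
        \<partial>distr (PiM {..<k} (\<lambda>_. H)) H (\<lambda>Ms. Ms (blk i))) =
        (\<integral>\<^sup>+Ms. indicator A (ls i * (Ms (blk i) *v z) $ pos i) \<partial>PiM {..<k} (\<lambda>_. H))"
      by (intro nn_integral_distr measurable_component_singleton, use blk[OF i] in simp) measurable
    then show "(\<integral>\<^sup>+Ms. indicator A (ls i * (Ms (blk i) *v z) $ pos i) \<partial>PiM {..<k} (\<lambda>_. H)) =
        (\<integral>\<^sup>+M. indicator A (ls i * (M *v z) $ pos i) \<partial>H)"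
      using distr_PiM_component[of "{..<k}" "\<lambda>_. H" "blk i"] blk[OF i] prob_space_DH by simp
  qed
  also have "\<dots> = (\<integral>\<^sup>+l. \<integral>\<^sup>+M. indicator A (l * (M *v z) $ pos i) \<partial>H \<partial>?L)"
  proof -
    have "(\<integral>\<^sup>+l. \<integral>\<^sup>+M. indicator A (l * (M *v z) $ pos i) \<partial>H
        \<partial>distr (PiM {..<s} (\<lambda>_. ?L)) ?L (\<lambda>ls. ls i)) =
        (\<integral>\<^sup>+ls. \<integral>\<^sup>+M. indicator A (ls i * (M *v z) $ pos i) \<partial>H \<partial>PiM {..<s} (\<lambda>_. ?L))"
      by (intro nn_integral_distr measurable_component_singleton, use i in simp) measurable
    then show ?thesis
      using distr_PiM_component[of "{..<s}" "\<lambda>_. ?L" i] i prob_space_norm by simp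
  qed
  also have "\<dots> = (\<integral>\<^sup>+w. \<integral>\<^sup>+M. indicator A (norm w * (M *v z) $ pos i) \<partial>H \<partial>D)"
    by (intro nn_integral_distr) measurable
  also have "\<dots> = (\<integral>\<^sup>+w. indicator A (w \<bullet> z) \<partial>D)"
    by (intro isotropic_marginal[symmetric] iso haar) measurable
  also have "\<dots> = emeasure (distr D borel (\<lambda>w. w \<bullet> z)) A"
    by (subst nn_integral_indicator[symmetric], simp, subst nn_integral_distr) measurable
  finally show "emeasure (distr (ort_space D H k s) borel (ort_proj z blk pos i)) A =
      emeasure (distr D borel (\<lambda>w. w \<bullet> z)) A" .
qed simp

text \<open>Given the lengths, different blocks are independent and factor exactly; inside a block
  the negative dependence of the coordinates gives the inequality. The lengths are independent of
  each other, so the outer integral factors too.\<close>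

lemma ort_space_product_le:
  fixes h :: "nat \<Rightarrow> real \<Rightarrow> ennreal"
  assumes h [measurable]: "\<And>i. h i \<in> borel_measurable borel"
    and R: "R = (\<le>) \<or> R = (\<ge>)"
    and mono: "\<And>i. i < s \<Longrightarrow> monotone_on {0..} (\<le>) R (h i)"
  shows "(\<integral>\<^sup>+x. (\<Prod>i<s. h i \<bar>ort_proj z blk pos i x\<bar>) \<partial>ort_space D H k s)
    \<le> (\<Prod>i<s. \<integral>\<^sup>+w. h i \<bar>w \<bullet> z\<bar> \<partial>D)"
proof -
  let ?L = "distr D borel norm"
  interpret H: prob_space H by (rule prob_space_DH)
  interpret L: prob_space ?L by (rule prob_space_norm)
  interpret PH: product_sigma_finite "\<lambda>_::nat. H" ..
  interpret PL: product_sigma_finite "\<lambda>_::nat. ?L" ..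
  \<comment> \<open>The absolute value of \<open>l\<close> matters because the integration variable
    is an arbitrary real: scaling by a nonnegative number keeps the direction of
    monotonicity.\<close>
  define \<psi> where "\<psi> i l = (\<integral>\<^sup>+M. h i (\<bar>l\<bar> * \<bar>(M *v z) $ pos i\<bar>) \<partial>H)" for i l
  define B where "B b = {i\<in>{..<s}. blk i = b}" for b
  have group: "(\<Prod>b<k. \<Prod>i\<in>B b. F i) = (\<Prod>i<s. F i)" for F :: "nat \<Rightarrow> ennreal"
    unfolding B_def using blk by (intro prod.group) auto
  have "(\<integral>\<^sup>+x. (\<Prod>i<s. h i \<bar>ort_proj z blk pos i x\<bar>) \<partial>ort_space D H k s) =
      (\<integral>\<^sup>+ls. \<integral>\<^sup>+Ms. (\<Prod>i<s. h i (\<bar>ls i\<bar> * \<bar>(Ms (blk i) *v z) $ pos i\<bar>))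
        \<partial>PiM {..<k} (\<lambda>_. H) \<partial>PiM {..<s} (\<lambda>_. ?L))"
    by (subst nn_integral_ort_space, measurable) (simp_all add: ort_proj_def abs_mult)
  also have "\<dots> \<le> (\<integral>\<^sup>+ls. (\<Prod>i<s. \<psi> i (ls i)) \<partial>PiM {..<s} (\<lambda>_. ?L))"
  proof (rule nn_integral_mono)
    fix ls :: "nat \<Rightarrow> real"
    have "(\<integral>\<^sup>+Ms. (\<Prod>i<s. h i (\<bar>ls i\<bar> * \<bar>(Ms (blk i) *v z) $ pos i\<bar>)) \<partial>PiM {..<k} (\<lambda>_. H)) =
        (\<integral>\<^sup>+Ms. (\<Prod>b<k. \<Prod>i\<in>B b. h i (\<bar>ls i\<bar> * \<bar>(Ms b *v z) $ pos i\<bar>)) \<partial>PiM {..<k} (\<lambda>_. H))"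
      by (subst group[symmetric]) (auto simp: B_def intro!: nn_integral_cong prod.cong)
    also have "\<dots> = (\<Prod>b<k. \<integral>\<^sup>+M. (\<Prod>i\<in>B b. h i (\<bar>ls i\<bar> * \<bar>(M *v z) $ pos i\<bar>)) \<partial>H)"
      by (rule PH.product_nn_integral_prod) measurable
    also have "\<dots> \<le> (\<Prod>b<k. \<Prod>i\<in>B b. \<psi> i (ls i))"
      unfolding \<psi>_def
    proof (rule prod_mono_ennreal,
        rule haar_negative_orthant_dependence[OF haar _ _ _ R, where h = "\<lambda>i t. h i (\<bar>ls i\<bar> * t)"])
      fix b i assume "i \<in> B b"
      then have "monotone_on {0..} (\<le>) R (h i)"
        using mono[of i] by (simp add: B_def)
      then show "monotone_on {0..} (\<le>) R (\<lambda>t. h i (\<bar>ls i\<bar> * t))"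
        by (simp add: monotone_on_def mult_left_mono)
    qed (use inj in \<open>simp_all add: B_def inj_on_def\<close>)
    finally show "(\<integral>\<^sup>+Ms. (\<Prod>i<s. h i (\<bar>ls i\<bar> * \<bar>(Ms (blk i) *v z) $ pos i\<bar>)) \<partial>PiM {..<k} (\<lambda>_. H))
        \<le> (\<Prod>i<s. \<psi> i (ls i))"
      by (simp add: group)
  qed
  also have "\<dots> = (\<Prod>i<s. \<integral>\<^sup>+l. \<psi> i l \<partial>?L)"
    unfolding \<psi>_def by (rule PL.product_nn_integral_prod) measurable
  also have "\<dots> = (\<Prod>i<s. \<integral>\<^sup>+w. h i \<bar>w \<bullet> z\<bar> \<partial>D)"
  proof (rule prod.cong)
    fix i
    have "(\<integral>\<^sup>+l. \<psi> i l \<partial>?L) = (\<integral>\<^sup>+w. \<psi> i (norm w) \<partial>D)"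
      unfolding \<psi>_def by (intro nn_integral_distr) measurable
    also have "\<dots> = (\<integral>\<^sup>+w. h i \<bar>w \<bullet> z\<bar> \<partial>D)"
      unfolding \<psi>_def
      using isotropic_marginal[OF iso haar, of "\<lambda>u. h i \<bar>u\<bar>" z "pos i"] by (simp add: abs_mult)
    finally show "(\<integral>\<^sup>+l. \<psi> i l \<partial>?L) = (\<integral>\<^sup>+w. h i \<bar>w \<bullet> z\<bar> \<partial>D)" .
  qed simp
  finally show ?thesis .
qed

end

section \<open>Concentration and mean squared error\<close>

text \<open>For \<open>0 < p < \<infinity>\<close>, the bound \<open>p \<le> exp_neg c L\<close> is
  equivalent to \<open>L \<le> - ln p / c\<close>, an upper bound on \<open>L\<close> that passes to
  the supremum.\<close>

lemma le_exp_neg_SUP: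
  assumes "c > 0" "p < \<infinity>" and le: "\<And>t. t \<in> T \<Longrightarrow> p \<le> exp_neg c (G t)"
  shows "p \<le> exp_neg c (SUP t\<in>T. G t)"
proof (cases "p = 0")
  case False
  with \<open>p < \<infinity>\<close> obtain q where q: "p = ennreal q" "q > 0"
    by (cases p) auto
  have "(SUP t\<in>T. G t) \<le> ereal (- ln q / c)"
  proof (rule SUP_least)
    fix t assume "t \<in> T"
    from le[OF this] q \<open>c > 0\<close> show "G t \<le> ereal (- ln q / c)"
      by (cases "G t") (auto simp: exp_neg_def ln_le_cancel_iff[of q "exp _", symmetric] field_simps
          simp del: ln_le_cancel_iff)
  qed
  moreover have "q \<le> exp (- (c * r))" if "r \<le> - (ln q / c)" for r
  proof -
    have "ln q \<le> - (c * r)"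
      using that \<open>c > 0\<close> by (simp add: field_simps)
    then show ?thesis
      using q exp_le_cancel_iff[of "ln q" "- (c * r)"] by simp
  qed
  ultimately show ?thesis
    using q by (cases "SUP t\<in>T. G t") (auto simp: exp_neg_def)
qed simp

text \<open>Reduces a product bound over all samples to one about two samples, by choosing the other
  factors to be 1.\<close>

lemma prod_pair:
  fixes a :: "nat \<Rightarrow> 'a::comm_monoid_mult"
  assumes "i < s" "j < s" "i \<noteq> j"
  shows "(\<Prod>m<s. if m = i \<or> m = j then a m else 1) = a i * a j"
proof -
  have "(\<Prod>m<s. if m = i \<or> m = j then a m else 1) = (\<Prod>m\<in>{i, j}. a m)"
    using assms by (intro prod.mono_neutral_cong_right) auto
  then show ?thesis using assms by simp
qed

lemma integrable_mult_square:
  fixes X Y :: "'a \<Rightarrow> real"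
  assumes "integrable M X" "integrable M Y"
    and "integrable M (\<lambda>x. (X x)\<^sup>2)" "integrable M (\<lambda>x. (Y x)\<^sup>2)"
  shows "integrable M (\<lambda>x. X x * Y x)"
proof (rule Bochner_Integration.integrable_bound)
  show "integrable M (\<lambda>x. (X x)\<^sup>2 + (Y x)\<^sup>2)"
    using assms by auto
  show "(\<lambda>x. X x * Y x) \<in> borel_measurable M"
    using assms by (auto intro: borel_measurable_times borel_measurable_integrable)
  have "\<bar>u * v\<bar> \<le> u\<^sup>2 + v\<^sup>2" for u v :: real
    using sum_squares_bound[of "\<bar>u\<bar>" "\<bar>v\<bar>"] abs_ge_zero[of "u * v"]
    unfolding abs_mult power2_abs by linarith
  then show "AE x in M. norm (X x * Y x) \<le> norm ((X x)\<^sup>2 + (Y x)\<^sup>2)"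
    by simp
qed

text \<open>Expanding the square uses no independence, so the same formula covers both estimators
  and they can be compared term by term through their mixed second moments.\<close>

lemma (in prob_space) mean_square_error_average:
  fixes X :: "nat \<Rightarrow> 'a \<Rightarrow> real"
  assumes "s > 0" and int: "\<And>i. i < s \<Longrightarrow> integrable M (X i)"
    and int2: "\<And>i. i < s \<Longrightarrow> integrable M (\<lambda>x. (X i x)\<^sup>2)"
    and mean: "\<And>i. i < s \<Longrightarrow> (\<integral>x. X i x \<partial>M) = m"
  shows "(\<integral>x. ((\<Sum>i<s. X i x) / real s - m)\<^sup>2 \<partial>M) =
    (\<Sum>i<s. \<Sum>j<s. \<integral>x. X i x * X j x \<partial>M) / (real s)\<^sup>2 - m\<^sup>2"
proof -
  have intp: "integrable M (\<lambda>x. X i x * X j x)" if "i < s" "j < s" for i j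
    using int int2 that by (intro integrable_mult_square) auto
  have intS: "integrable M (\<lambda>x. \<Sum>i<s. X i x)" "integrable M (\<lambda>x. \<Sum>i<s. \<Sum>j<s. X i x * X j x)"
    using int intp by (auto intro!: Bochner_Integration.integrable_sum)
  have int_sum: "(\<integral>x. (\<Sum>i<s. X i x) \<partial>M) = (\<Sum>i<s. \<integral>x. X i x \<partial>M)"
    using int by (intro Bochner_Integration.integral_sum) auto
  have int_sum2: "(\<integral>x. (\<Sum>i<s. \<Sum>j<s. X i x * X j x) \<partial>M) = (\<Sum>i<s. \<Sum>j<s. \<integral>x. X i x * X j x \<partial>M)"
    using intp by (subst Bochner_Integration.integral_sum)
      (auto intro!: Bochner_Integration.integrable_sum sum.cong Bochner_Integration.integral_sum)
  have "((\<Sum>i<s. X i x) / real s - m)\<^sup>2 =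
      (\<Sum>i<s. \<Sum>j<s. X i x * X j x) / (real s)\<^sup>2 - 2 * m / real s * (\<Sum>i<s. X i x) + m\<^sup>2" for x
  proof -
    have "(\<Sum>i<s. \<Sum>j<s. X i x * X j x) = (\<Sum>i<s. X i x)\<^sup>2"
      by (simp add: power2_eq_square sum_product)
    then show ?thesis
      by (simp add: power2_diff power_divide)
  qed
  then have "(\<integral>x. ((\<Sum>i<s. X i x) / real s - m)\<^sup>2 \<partial>M) =
      (\<Sum>i<s. \<Sum>j<s. \<integral>x. X i x * X j x \<partial>M) / (real s)\<^sup>2 - 2 * m / real s * (\<Sum>i<s. \<integral>x. X i x \<partial>M) + m\<^sup>2"
    using intS by (simp add: prob_space int_sum int_sum2)
  also have "(\<Sum>i<s. \<integral>x. X i x \<partial>M) = real s * m"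
    by (simp add: mean)
  finally show ?thesis
    using \<open>s > 0\<close> by (simp add: power2_eq_square)
qed

text \<open>Class F1 is expressed through \<open>f\<close> alone, as evenness together with
  monotonicity on the half-line.\<close>

locale orthogonal_estimator = orthogonal_ensemble D H s k blk pos z
  for D :: "(real^'n) measure" and H s k blk pos z +
  fixes f :: "real \<Rightarrow> real"
  assumes s_pos: "s > 0"
    and even: "\<And>u. f \<bar>u\<bar> = f u"
    and mono: "monotone_on {0..} (\<le>) (\<le>) f \<or> monotone_on {0..} (\<le>) (\<ge>) f"
    and intX: "integrable D (\<lambda>w. f (w \<bullet> z))"
begin

text \<open>Measurability follows from monotonicity: \<open>max 0\<close> extends the restriction of
  \<open>f\<close> to the half-line to a monotone function on the whole line, and \<open>f\<close>
  is that function after the absolute value. The decreasing case goes through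
  \<open>- f\<close>.\<close>

lemma measurable_f [measurable]: "f \<in> borel_measurable borel"
proof -
  have *: "(\<lambda>u. h (max 0 \<bar>u\<bar>)) \<in> borel_measurable borel"
    if "monotone_on {0..} (\<le>) (\<le>) h" for h :: "real \<Rightarrow> real"
  proof -
    have "mono (\<lambda>u. h (max 0 u))"
      using that by (auto simp: monotone_on_def intro!: monoI)
    then have [measurable]: "(\<lambda>u. h (max 0 u)) \<in> borel_measurable borel"
      by (rule borel_measurable_mono)
    show ?thesis by measurable
  qed
  from mono show ?thesis
  proof
    assume "monotone_on {0..} (\<le>) (\<le>) f"
    from *[OF this] show ?thesis by (simp add: even)
  next
    assume "monotone_on {0..} (\<le>) (\<ge>) f"
    then have "monotone_on {0..} (\<le>) (\<le>) (\<lambda>u. - f u)" by (simp add: monotone_on_def)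
    from *[OF this] show ?thesis by (simp add: even)
  qed
qed

abbreviation "\<Omega> \<equiv> ort_space D H k s"
abbreviation "X i x \<equiv> f (ort_proj z blk pos i x)"
abbreviation "m \<equiv> F_true D f z"

lemma integral_proj:
  fixes G :: "real \<Rightarrow> real"
  assumes "i < s" and [measurable]: "G \<in> borel_measurable borel"
  shows "integrable \<Omega> (\<lambda>x. G (ort_proj z blk pos i x)) \<longleftrightarrow> integrable D (\<lambda>w. G (w \<bullet> z))"
    and "(\<integral>x. G (ort_proj z blk pos i x) \<partial>\<Omega>) = (\<integral>w. G (w \<bullet> z) \<partial>D)"
proof -
  note \<open>i < s\<close> [simp]
  have distr: "distr \<Omega> borel (ort_proj z blk pos i) = distr D borel (\<lambda>w. w \<bullet> z)"
    using \<open>i < s\<close> by (rule distr_ort_proj)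
  have "integrable \<Omega> (\<lambda>x. G (ort_proj z blk pos i x)) \<longleftrightarrow>
      integrable (distr \<Omega> borel (ort_proj z blk pos i)) G"
    by (rule integrable_distr_eq[symmetric]) measurable
  also have "\<dots> \<longleftrightarrow> integrable D (\<lambda>w. G (w \<bullet> z))"
    unfolding distr by (rule integrable_distr_eq) measurable
  finally show "integrable \<Omega> (\<lambda>x. G (ort_proj z blk pos i x)) \<longleftrightarrow> integrable D (\<lambda>w. G (w \<bullet> z))" .
  have "(\<integral>x. G (ort_proj z blk pos i x) \<partial>\<Omega>) = (\<integral>u. G u \<partial>distr \<Omega> borel (ort_proj z blk pos i))"
    by (rule integral_distr[symmetric]) measurable
  also have "\<dots> = (\<integral>w. G (w \<bullet> z) \<partial>D)"
    unfolding distr by (rule integral_distr) measurable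
  finally show "(\<integral>x. G (ort_proj z blk pos i x) \<partial>\<Omega>) = (\<integral>w. G (w \<bullet> z) \<partial>D)" .
qed

lemma integrable_X: "i < s \<Longrightarrow> integrable \<Omega> (X i)"
  using integral_proj(1)[of i f] intX by simp

lemma mean_X: "i < s \<Longrightarrow> (\<integral>x. X i x \<partial>\<Omega>) = m"
  using integral_proj(2)[of i f] by (simp add: F_true_def)

lemma F_ort_unbiased: "integrable \<Omega> (F_ort f z blk pos s)" "(\<integral>x. F_ort f z blk pos s x \<partial>\<Omega>) = m"
proof -
  have eq: "F_ort f z blk pos s = (\<lambda>x. (\<Sum>i<s. X i x) / real s)"
    by (simp add: F_ort_eq fun_eq_iff)
  show "integrable \<Omega> (F_ort f z blk pos s)"
    unfolding eq using integrable_X by (intro integrable_divide Bochner_Integration.integrable_sum) simp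
  show "(\<integral>x. F_ort f z blk pos s x \<partial>\<Omega>) = m"
    unfolding eq using integrable_X mean_X s_pos by (simp add: Bochner_Integration.integral_sum)
qed

section \<open>Exponential moments and tail bounds\<close>

lemma mgf_X: "mgf (X_dist D f z) \<theta> = (\<integral>\<^sup>+w. ennreal (exp (\<theta> * f (w \<bullet> z))) \<partial>D)"
  unfolding mgf_def X_dist_def by (rule nn_integral_distr) measurable

text \<open>Markov's inequality for the exponential of the sum, followed by the product bound.
  Keeping \<open>\<theta>\<close> on both sides of the event covers the upper tail for positive and
  the lower tail for negative \<open>\<theta>\<close>; for either sign
  \<open>exp (\<theta> * f u)\<close> is monotone in one direction on the half-line.\<close>

lemma chernoff:
  "emeasure \<Omega> {x\<in>space \<Omega>. \<theta> * (real s * a) \<le> \<theta> * (\<Sum>i<s. X i x)}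
    \<le> ennreal (exp (- (\<theta> * (real s * a)))) * mgf (X_dist D f z) \<theta> ^ s"
proof -
  let ?h = "\<lambda>u. ennreal (exp (\<theta> * f u))"
  have h: "monotone_on {0..} (\<le>) (\<le>) ?h \<or> monotone_on {0..} (\<le>) (\<ge>) ?h"
    using mono linear[of 0 \<theta>]
    by (auto simp: monotone_on_def intro: mult_left_mono mult_left_mono_neg)
  have "emeasure \<Omega> {x\<in>space \<Omega>. \<theta> * (real s * a) \<le> \<theta> * (\<Sum>i<s. X i x)} =
      (\<integral>\<^sup>+x. indicator {x\<in>space \<Omega>. \<theta> * (real s * a) \<le> \<theta> * (\<Sum>i<s. X i x)} x \<partial>\<Omega>)"
    by (rule nn_integral_indicator[symmetric]) measurable
  also have "\<dots> \<le> (\<integral>\<^sup>+x. ennreal (exp (- (\<theta> * (real s * a)))) * (\<Prod>i<s. ?h (ort_proj z blk pos i x)) \<partial>\<Omega>)"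
  proof (rule nn_integral_mono)
    fix x
    have "1 \<le> exp (- (\<theta> * (real s * a))) * (\<Prod>i<s. exp (\<theta> * X i x))"
      if "\<theta> * (real s * a) \<le> \<theta> * (\<Sum>i<s. X i x)"
      using that by (simp add: exp_sum[symmetric] exp_add[symmetric] sum_distrib_left)
    then show "indicator {x\<in>space \<Omega>. \<theta> * (real s * a) \<le> \<theta> * (\<Sum>i<s. X i x)} x \<le>
        ennreal (exp (- (\<theta> * (real s * a)))) * (\<Prod>i<s. ?h (ort_proj z blk pos i x))"
      by (auto simp: indicator_def prod_ennreal ennreal_mult[symmetric] prod_nonneg)
  qed
  also have "\<dots> = ennreal (exp (- (\<theta> * (real s * a)))) *
      (\<integral>\<^sup>+x. (\<Prod>i<s. ?h \<bar>ort_proj z blk pos i x\<bar>) \<partial>\<Omega>)"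
    unfolding even by (rule nn_integral_cmult) measurable
  also have "\<dots> \<le> ennreal (exp (- (\<theta> * (real s * a)))) * (\<Prod>i<s. \<integral>\<^sup>+w. ?h \<bar>w \<bullet> z\<bar> \<partial>D)"
  proof (rule mult_left_mono)
    have [measurable]: "?h \<in> borel_measurable borel" by measurable
    show "(\<integral>\<^sup>+x. (\<Prod>i<s. ?h \<bar>ort_proj z blk pos i x\<bar>) \<partial>\<Omega>) \<le> (\<Prod>i<s. \<integral>\<^sup>+w. ?h \<bar>w \<bullet> z\<bar> \<partial>D)"
      using h
    proof
      assume "monotone_on {0..} (\<le>) (\<le>) ?h"
      then show ?thesis
        by (intro ort_space_product_le[of "\<lambda>_. ?h" "(\<le>)"]) simp_all
    next
      assume "monotone_on {0..} (\<le>) (\<ge>) ?h"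
      then show ?thesis
        by (intro ort_space_product_le[of "\<lambda>_. ?h" "(\<ge>)"]) simp_all
    qed
  qed simp
  finally show ?thesis
    by (simp add: even mgf_X)
qed

lemma emeasure_deviation_le:
  assumes "\<epsilon> > 0"
  shows "emeasure \<Omega> {x\<in>space \<Omega>. \<bar>F_ort f z blk pos s x - m\<bar> \<ge> \<epsilon>} \<le>
    emeasure \<Omega> {x\<in>space \<Omega>. real s * (m + \<epsilon>) \<le> (\<Sum>i<s. X i x)} +
    emeasure \<Omega> {x\<in>space \<Omega>. (\<Sum>i<s. X i x) \<le> real s * (m - \<epsilon>)}"
proof -
  have "emeasure \<Omega> {x\<in>space \<Omega>. \<bar>F_ort f z blk pos s x - m\<bar> \<ge> \<epsilon>} \<le>
    emeasure \<Omega> ({x\<in>space \<Omega>. real s * (m + \<epsilon>) \<le> (\<Sum>i<s. X i x)} \<union>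
      {x\<in>space \<Omega>. (\<Sum>i<s. X i x) \<le> real s * (m - \<epsilon>)})"
  proof (rule emeasure_mono)
    show "{x\<in>space \<Omega>. \<bar>F_ort f z blk pos s x - m\<bar> \<ge> \<epsilon>} \<subseteq>
        {x\<in>space \<Omega>. real s * (m + \<epsilon>) \<le> (\<Sum>i<s. X i x)} \<union>
        {x\<in>space \<Omega>. (\<Sum>i<s. X i x) \<le> real s * (m - \<epsilon>)}"
      using s_pos by (auto simp: F_ort_eq field_simps abs_if split: if_splits)
  qed measurable
  also have "\<dots> \<le> emeasure \<Omega> {x\<in>space \<Omega>. real s * (m + \<epsilon>) \<le> (\<Sum>i<s. X i x)} +
    emeasure \<Omega> {x\<in>space \<Omega>. (\<Sum>i<s. X i x) \<le> real s * (m - \<epsilon>)}"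
    by (rule emeasure_subadditive) measurable
  finally show ?thesis .
qed

text \<open>\<open>T\<close> is a set of parameters that all describe the same event
  \<open>A\<close>: the positive ones for the upper tail, the negative ones for the lower tail. A
  parameter with infinite moment generating function contributes the trivial bound.\<close>

lemma chernoff_exp_neg:
  assumes "\<And>\<theta>. \<theta> \<in> T \<Longrightarrow> A = {x\<in>space \<Omega>. \<theta> * (real s * a) \<le> \<theta> * (\<Sum>i<s. X i x)}"
  shows "emeasure \<Omega> A \<le> exp_neg (real s) (SUP \<theta>\<in>T. if mgf (X_dist D f z) \<theta> = \<infinity> then -\<infinity>
      else ereal (\<theta> * a - ln (enn2real (mgf (X_dist D f z) \<theta>))))"
proof (rule le_exp_neg_SUP)
  interpret prob_space \<Omega> by (rule prob_space_ort_space)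
  show "emeasure \<Omega> A < \<infinity>"
    by (simp add: less_top[symmetric])
  fix \<theta> assume "\<theta> \<in> T"
  let ?\<mu> = "mgf (X_dist D f z) \<theta>"
  have le: "emeasure \<Omega> A \<le> ennreal (exp (- (\<theta> * (real s * a)))) * ?\<mu> ^ s"
    using chernoff[of \<theta> a] assms[OF \<open>\<theta> \<in> T\<close>] by simp
  show "emeasure \<Omega> A \<le> exp_neg (real s) (if ?\<mu> = \<infinity> then -\<infinity> else ereal (\<theta> * a - ln (enn2real ?\<mu>)))"
  proof (cases "?\<mu> = \<infinity>")
    case False
    interpret D: prob_space D using iso by (simp add: isotropic_def)
    \<comment> \<open>The exponential is positive everywhere, so its integral cannot vanish; this
      keeps \<open>ln\<close> away from 0.\<close>
    have "?\<mu> \<noteq> 0"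
      unfolding mgf_X by (subst nn_integral_0_iff_AE) (simp_all add: D.AE_False)
    with False obtain r where r: "?\<mu> = ennreal r" "r > 0"
      by (cases ?\<mu>) auto
    have "exp (- (\<theta> * (real s * a))) * r ^ s = exp (- real s * (\<theta> * a - ln r))"
      using \<open>r > 0\<close> by (simp add: algebra_simps exp_diff exp_of_nat_mult exp_minus field_simps)
    then show ?thesis
      using le r False by (simp add: exp_neg_def ennreal_power ennreal_mult[symmetric])
  qed (simp add: exp_neg_def)
qed (use s_pos in simp)

lemma F_ort_cramer_chernoff:
  assumes "\<epsilon> > 0"
  shows "emeasure \<Omega> {x\<in>space \<Omega>. \<bar>F_ort f z blk pos s x - m\<bar> \<ge> \<epsilon>} \<le>
    exp_neg (real s) (legendre (X_dist D f z) (m + \<epsilon>)) +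
    exp_neg (real s) (legendre (X_dist D f z) (m - \<epsilon>))"
proof -
  have m: "(\<integral>x. x \<partial>X_dist D f z) = m"
    unfolding X_dist_def F_true_def by (rule integral_distr) measurable
  have "emeasure \<Omega> {x\<in>space \<Omega>. real s * (m + \<epsilon>) \<le> (\<Sum>i<s. X i x)} \<le>
      exp_neg (real s) (legendre (X_dist D f z) (m + \<epsilon>))"
    unfolding legendre_def Let_def m if_P[OF less_add_same_cancel1[THEN iffD2, OF \<open>\<epsilon> > 0\<close>]]
    by (rule chernoff_exp_neg) (simp add: mult_le_cancel_left)
  \<comment> \<open>These two facts select the second branch of \<open>legendre\<close>, the
    supremum over negative \<open>\<theta>\<close>.\<close>
  moreover have "\<not> m < m - \<epsilon>" "m - \<epsilon> < m"
    using \<open>\<epsilon> > 0\<close> by auto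
  then have "emeasure \<Omega> {x\<in>space \<Omega>. (\<Sum>i<s. X i x) \<le> real s * (m - \<epsilon>)} \<le>
      exp_neg (real s) (legendre (X_dist D f z) (m - \<epsilon>))"
    unfolding legendre_def Let_def m
    by (simp only: if_True if_False, intro chernoff_exp_neg) (simp add: mult_le_cancel_left)
  ultimately show ?thesis
    by (rule order_trans[OF emeasure_deviation_le[OF \<open>\<epsilon> > 0\<close>] add_mono])
qed

lemma F_ort_hoeffding:
  assumes ab: "\<And>u. a \<le> f u \<and> f u \<le> b" and "\<epsilon> > 0"
  shows "measure \<Omega> {x\<in>space \<Omega>. \<bar>F_ort f z blk pos s x - m\<bar> \<ge> \<epsilon>}
    \<le> 2 * exp (- 2 * real s * \<epsilon>\<^sup>2 / (b - a)\<^sup>2)"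
\<comment> \<open>For \<open>a = b\<close> the exponent is a division by 0, hence 0, and the claimed
  bound is 2.\<close>
proof (cases "a = b")
  case True
  interpret prob_space \<Omega> by (rule prob_space_ort_space)
  show ?thesis
    using True by (simp add: order_trans[OF prob_le_1])
next
  case False
  with ab[of 0] have "a < b" by linarith
  interpret prob_space \<Omega> by (rule prob_space_ort_space)
  interpret D: prob_space D using iso by (simp add: isotropic_def)
  interpret I: interval_bounded_random_variable D "\<lambda>w. f (w \<bullet> z)" a b
    by unfold_locales (use ab in auto)
  \<comment> \<open>Hoeffding's lemma is applied with a positive parameter only; negative
    \<open>\<theta>\<close> is handled by \<open>- \<theta>\<close> and the reflected
    variable.\<close>
  interpret J: interval_bounded_random_variable D "\<lambda>w. - f (w \<bullet> z)" "- b" "- a"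
    by unfold_locales (use ab in auto)
  have mgf_le: "mgf (X_dist D f z) \<theta> \<le> ennreal (exp (\<theta> * m + \<theta>\<^sup>2 * (b - a)\<^sup>2 / 8))"
    if "\<theta> \<noteq> 0" for \<theta>
  proof -
    have "(\<integral>\<^sup>+w. ennreal (exp (\<theta> * (f (w \<bullet> z) - m))) \<partial>D) \<le> ennreal (exp (\<theta>\<^sup>2 * (b - a)\<^sup>2 / 8))"
    proof (cases "\<theta> > 0")
      case True
      then show ?thesis
        using I.Hoeffdings_lemma_nn_integral[of \<theta>] by (simp add: F_true_def)
    next
      case False
      with \<open>\<theta> \<noteq> 0\<close> have "- \<theta> > 0" by simp
      from J.Hoeffdings_lemma_nn_integral[OF this] show ?thesis
        by (simp add: F_true_def algebra_simps)
    qed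
    then have "ennreal (exp (\<theta> * m)) * (\<integral>\<^sup>+w. ennreal (exp (\<theta> * (f (w \<bullet> z) - m))) \<partial>D)
        \<le> ennreal (exp (\<theta> * m)) * ennreal (exp (\<theta>\<^sup>2 * (b - a)\<^sup>2 / 8))"
      by (rule mult_left_mono) simp
    then show ?thesis
      by (simp add: mgf_X nn_integral_cmult[symmetric] ennreal_mult[symmetric] exp_add[symmetric]
          algebra_simps)
  qed
  \<comment> \<open>This \<open>\<theta>\<close> minimises the exponent
    \<open>\<theta>\<^sup>2 * (b - a)\<^sup>2 / 8 - \<theta> * \<delta>\<close>. The two tails are
    \<open>\<delta> = \<epsilon>\<close> and \<open>\<delta> = - \<epsilon>\<close>.\<close>
  have tail: "emeasure \<Omega> {x\<in>space \<Omega>. \<theta> * (real s * (m + \<delta>)) \<le> \<theta> * (\<Sum>i<s. X i x)}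
      \<le> ennreal (exp (- 2 * real s * \<epsilon>\<^sup>2 / (b - a)\<^sup>2))"
    if \<delta>: "\<delta>\<^sup>2 = \<epsilon>\<^sup>2" and \<theta>: "\<theta> = 4 * \<delta> / (b - a)\<^sup>2" for \<theta> \<delta>
  proof -
    have "\<theta> \<noteq> 0"
      using \<delta> \<theta> \<open>\<epsilon> > 0\<close> \<open>a < b\<close> by auto
    have "emeasure \<Omega> {x\<in>space \<Omega>. \<theta> * (real s * (m + \<delta>)) \<le> \<theta> * (\<Sum>i<s. X i x)} \<le>
        ennreal (exp (- (\<theta> * (real s * (m + \<delta>))))) * mgf (X_dist D f z) \<theta> ^ s"
      by (rule chernoff)
    also have "\<dots> \<le> ennreal (exp (- (\<theta> * (real s * (m + \<delta>))))) *
        ennreal (exp (\<theta> * m + \<theta>\<^sup>2 * (b - a)\<^sup>2 / 8)) ^ s"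
      using mgf_le[OF \<open>\<theta> \<noteq> 0\<close>] by (intro mult_left_mono power_mono) auto
    also have "\<dots> = ennreal (exp (real s * (\<theta>\<^sup>2 * (b - a)\<^sup>2 / 8 - \<theta> * \<delta>)))"
      by (simp add: ennreal_power ennreal_mult[symmetric] exp_of_nat_mult[symmetric]
          exp_add[symmetric] algebra_simps)
    also have "\<theta>\<^sup>2 * (b - a)\<^sup>2 / 8 - \<theta> * \<delta> = - 2 * \<delta>\<^sup>2 / (b - a)\<^sup>2"
    proof -
      have "(16 * \<delta>\<^sup>2 / (c * c)) * c / 8 - 4 * \<delta> / c * \<delta> = - 2 * \<delta>\<^sup>2 / c" if "c \<noteq> 0" for c
        using that by (simp add: field_simps power2_eq_square)
      from this[of "(b - a)\<^sup>2"] show ?thesis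
        using \<open>a < b\<close> unfolding \<theta> by (simp add: power_divide power_mult_distrib power2_eq_square[of "(b - a)\<^sup>2"])
    qed
    finally show ?thesis
      by (simp add: \<delta> mult_ac)
  qed
  define c where "c = 4 * \<epsilon> / (b - a)\<^sup>2"
  have "c > 0"
    using \<open>\<epsilon> > 0\<close> \<open>a < b\<close> by (simp add: c_def)
  have "emeasure \<Omega> {x\<in>space \<Omega>. real s * (m + \<epsilon>) \<le> (\<Sum>i<s. X i x)}
      \<le> ennreal (exp (- 2 * real s * \<epsilon>\<^sup>2 / (b - a)\<^sup>2))"
    using tail[OF refl c_def] by (simp only: mult_le_cancel_left_pos[OF \<open>c > 0\<close>])
  moreover have "emeasure \<Omega> {x\<in>space \<Omega>. (\<Sum>i<s. X i x) \<le> real s * (m - \<epsilon>)}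
      \<le> ennreal (exp (- 2 * real s * \<epsilon>\<^sup>2 / (b - a)\<^sup>2))"
    using tail[of "- \<epsilon>" "- c"] mult_le_cancel_left_neg[of "- c"] \<open>c > 0\<close>
    by (simp only: power2_minus c_def mult_minus_left mult_minus_right minus_divide_left
        neg_less_0_iff_less add_uminus_conv_diff simp_thms)
  ultimately have "emeasure \<Omega> {x\<in>space \<Omega>. \<bar>F_ort f z blk pos s x - m\<bar> \<ge> \<epsilon>} \<le>
      ennreal (exp (- 2 * real s * \<epsilon>\<^sup>2 / (b - a)\<^sup>2)) + ennreal (exp (- 2 * real s * \<epsilon>\<^sup>2 / (b - a)\<^sup>2))"
    by (rule order_trans[OF emeasure_deviation_le[OF \<open>\<epsilon> > 0\<close>] add_mono])
  then show ?thesis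
    by (simp add: emeasure_eq_measure flip: ennreal_plus)
qed

section \<open>Covariances and mean squared error\<close>

text \<open>Shifting and reflecting \<open>f\<close> makes it nonnegative without changing covariances.\<close>

lemma ort_product_le:
  assumes int2: "integrable D (\<lambda>w. (f (w \<bullet> z))\<^sup>2)" and ij: "i < s" "j < s" "i \<noteq> j"
  shows "(\<integral>x. X i x * X j x \<partial>\<Omega>) \<le> m\<^sup>2"
proof -
  interpret prob_space \<Omega> by (rule prob_space_ort_space)
  interpret D: prob_space D using iso by (simp add: isotropic_def)
  define \<sigma> :: real where "\<sigma> = (if monotone_on {0..} (\<le>) (\<le>) f then 1 else -1)"
  \<comment> \<open>The sign \<open>\<sigma>\<close> makes \<open>\<sigma> * f\<close> increasing on
    the half-line, so its least value is at 0; adding \<open>\<bar>f 0\<bar>\<close> makes that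
    value nonnegative.\<close>
  define v where "v u = \<bar>f 0\<bar> + \<sigma> * f u" for u
  have \<sigma>: "\<sigma> * \<sigma> = 1" by (simp add: \<sigma>_def)
  have v_mono: "monotone_on {0..} (\<le>) (\<le>) v"
    using mono by (auto simp: v_def \<sigma>_def monotone_on_def)
  have v_nonneg: "0 \<le> v u" for u
  proof -
    have "v 0 \<le> v \<bar>u\<bar>"
      using v_mono by (auto simp: monotone_on_def)
    moreover have "0 \<le> v 0"
      by (auto simp: v_def \<sigma>_def)
    ultimately show ?thesis
      by (simp add: v_def even)
  qed
  have v_even: "v \<bar>u\<bar> = v u" for u
    by (simp add: v_def even)
  have [measurable]: "v \<in> borel_measurable borel"
    unfolding v_def by measurable
  define h where "h l u = (if l = i \<or> l = j then ennreal (v u) else 1)" for l u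
  have [measurable]: "h l \<in> borel_measurable borel" for l
    unfolding h_def by measurable
  have Dv: "integrable D (\<lambda>w. v (w \<bullet> z))" "(\<integral>w. v (w \<bullet> z) \<partial>D) = \<bar>f 0\<bar> + \<sigma> * m"
    unfolding v_def F_true_def using intX by (auto simp: D.prob_space)
  have intXX: "integrable \<Omega> (\<lambda>x. X i x * X j x)"
    using ij integrable_X int2 integral_proj(1)[of _ "\<lambda>u. (f u)\<^sup>2"]
    by (intro integrable_mult_square) auto
  have "(\<integral>\<^sup>+x. (\<Prod>l<s. h l \<bar>ort_proj z blk pos l x\<bar>) \<partial>\<Omega>) \<le> (\<Prod>l<s. \<integral>\<^sup>+w. h l \<bar>w \<bullet> z\<bar> \<partial>D)"
    by (rule ort_space_product_le[of h "(\<le>)"])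
      (use v_mono v_nonneg in \<open>auto simp: h_def monotone_on_def\<close>)
  also have "(\<lambda>x. \<Prod>l<s. h l \<bar>ort_proj z blk pos l x\<bar>) =
      (\<lambda>x. ennreal (v (ort_proj z blk pos i x) * v (ort_proj z blk pos j x)))"
    unfolding h_def using ij by (simp add: prod_pair v_even ennreal_mult v_nonneg)
  also have "(\<Prod>l<s. \<integral>\<^sup>+w. h l \<bar>w \<bullet> z\<bar> \<partial>D) = (\<Prod>l<s. if l = i \<or> l = j then ennreal (\<bar>f 0\<bar> + \<sigma> * m) else 1)"
    using Dv by (intro prod.cong)
      (auto simp: h_def v_even nn_integral_eq_integral v_nonneg D.emeasure_space_1)
  also have "\<dots> = ennreal ((\<bar>f 0\<bar> + \<sigma> * m) * (\<bar>f 0\<bar> + \<sigma> * m))"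
  proof -
    have "0 \<le> \<bar>f 0\<bar> + \<sigma> * m"
      unfolding Dv(2)[symmetric] using v_nonneg by (intro integral_nonneg_AE) auto
    then show ?thesis
      using ij by (simp add: prod_pair ennreal_mult)
  qed
  also have "(\<integral>\<^sup>+x. ennreal (v (ort_proj z blk pos i x) * v (ort_proj z blk pos j x)) \<partial>\<Omega>) =
      ennreal (\<integral>x. v (ort_proj z blk pos i x) * v (ort_proj z blk pos j x) \<partial>\<Omega>)"
  proof (rule nn_integral_eq_integral)
    show "integrable \<Omega> (\<lambda>x. v (ort_proj z blk pos i x) * v (ort_proj z blk pos j x))"
      using integrable_X[OF ij(1)] integrable_X[OF ij(2)] intXX by (simp add: v_def algebra_simps)
  qed (simp add: v_nonneg)
  finally have "(\<integral>x. v (ort_proj z blk pos i x) * v (ort_proj z blk pos j x) \<partial>\<Omega>)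
      \<le> (\<bar>f 0\<bar> + \<sigma> * m) * (\<bar>f 0\<bar> + \<sigma> * m)"
    by (subst (asm) ennreal_le_iff) auto
  also have "(\<lambda>x. v (ort_proj z blk pos i x) * v (ort_proj z blk pos j x)) =
      (\<lambda>x. \<bar>f 0\<bar> * \<bar>f 0\<bar> + \<bar>f 0\<bar> * \<sigma> * X i x + \<bar>f 0\<bar> * \<sigma> * X j x + (\<sigma> * \<sigma>) * (X i x * X j x))"
    by (simp add: v_def algebra_simps fun_eq_iff)
  also have "(\<integral>x. \<bar>f 0\<bar> * \<bar>f 0\<bar> + \<bar>f 0\<bar> * \<sigma> * X i x + \<bar>f 0\<bar> * \<sigma> * X j x + (\<sigma> * \<sigma>) * (X i x * X j x) \<partial>\<Omega>) =
      \<bar>f 0\<bar> * \<bar>f 0\<bar> + \<bar>f 0\<bar> * \<sigma> * m + \<bar>f 0\<bar> * \<sigma> * m + (\<integral>x. X i x * X j x \<partial>\<Omega>)"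
    using integrable_X[OF ij(1)] integrable_X[OF ij(2)] intXX mean_X[OF ij(1)] mean_X[OF ij(2)]
    by (simp add: \<sigma> prob_space)
  \<comment> \<open>Expanding the square on the right produces the same constant and linear terms in
    \<open>m\<close> as on the left; they cancel and leave only the mixed moment and
    \<open>\<sigma> * \<sigma>\<close> times the squared mean.\<close>
  finally have "(\<integral>x. X i x * X j x \<partial>\<Omega>) \<le> (\<sigma> * \<sigma>) * m\<^sup>2"
    by (simp add: algebra_simps power2_eq_square)
  then show ?thesis
    by (simp add: \<sigma>)
qed

lemma iid_product:
  assumes ij: "i < s" "j < s" "i \<noteq> j"
  shows "(\<integral>x. f (x i \<bullet> z) * f (x j \<bullet> z) \<partial>iid_space D s) = m\<^sup>2"
proof -
  interpret D: prob_space D using iso by (simp add: isotropic_def)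
  interpret P: product_sigma_finite "\<lambda>_::nat. D" ..
  let ?h = "\<lambda>l w. if l = i \<or> l = j then f (w \<bullet> z) else 1"
  have "integrable D (?h l)" for l
    using intX by (cases "l = i \<or> l = j") auto
  then have "(\<integral>x. (\<Prod>l<s. ?h l (x l)) \<partial>iid_space D s) = (\<Prod>l<s. \<integral>w. ?h l w \<partial>D)"
    unfolding iid_space_def by (intro P.product_integral_prod) auto
  also have "\<dots> = (\<Prod>l<s. if l = i \<or> l = j then m else 1)"
    by (intro prod.cong) (auto simp: F_true_def D.prob_space)
  finally show ?thesis
    using ij by (simp add: prod_pair power2_eq_square)
qed

text \<open>The diagonal second moments agree because the marginals do. Off the diagonal the
  independent samples give exactly \<open>m\<^sup>2\<close>, and the orthogonal ones at most
  that.\<close>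

lemma F_ort_mse_le:
  assumes int2: "integrable D (\<lambda>w. (f (w \<bullet> z))\<^sup>2)"
  shows "(\<integral>x. (F_ort f z blk pos s x - m)\<^sup>2 \<partial>\<Omega>)
    \<le> (\<integral>x. (F_iid f z s x - m)\<^sup>2 \<partial>iid_space D s)"
proof -
  interpret prob_space \<Omega> by (rule prob_space_ort_space)
  interpret D: prob_space D using iso by (simp add: isotropic_def)
  interpret I: prob_space "iid_space D s"
    unfolding iid_space_def by (intro prob_space_PiM D.prob_space_axioms)
  have comp: "integrable (iid_space D s) (\<lambda>x. G (x i)) \<longleftrightarrow> integrable D G"
    "(\<integral>x. G (x i) \<partial>iid_space D s) = (\<integral>w. G w \<partial>D)"
    if [measurable]: "G \<in> borel_measurable borel" and "i < s" for i and G :: "real^'n \<Rightarrow> real"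
  proof -
    have distr: "distr (iid_space D s) D (\<lambda>x. x i) = D"
      unfolding iid_space_def using \<open>i < s\<close> D.prob_space_axioms by (intro distr_PiM_component) auto
    have [measurable]: "(\<lambda>x. x i) \<in> iid_space D s \<rightarrow>\<^sub>M D"
      unfolding iid_space_def using \<open>i < s\<close> by (intro measurable_component_singleton) simp
    have "integrable (distr (iid_space D s) D (\<lambda>x. x i)) G \<longleftrightarrow> integrable (iid_space D s) (\<lambda>x. G (x i))"
      by (rule integrable_distr_eq) measurable
    then show "integrable (iid_space D s) (\<lambda>x. G (x i)) \<longleftrightarrow> integrable D G"
      by (simp add: distr)
    have "(\<integral>w. G w \<partial>distr (iid_space D s) D (\<lambda>x. x i)) = (\<integral>x. G (x i) \<partial>iid_space D s)"
      by (rule integral_distr) measurable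
    then show "(\<integral>x. G (x i) \<partial>iid_space D s) = (\<integral>w. G w \<partial>D)"
      by (simp add: distr)
  qed
  have sq: "(\<integral>x. X i x * X i x \<partial>\<Omega>) = (\<integral>x. f (x i \<bullet> z) * f (x i \<bullet> z) \<partial>iid_space D s)" if "i < s" for i
    using integral_proj(2)[OF that, of "\<lambda>u. f u * f u"] comp(2)[OF _ that, of "\<lambda>w. f (w \<bullet> z) * f (w \<bullet> z)"]
    by simp
  have "(\<integral>x. (F_ort f z blk pos s x - m)\<^sup>2 \<partial>\<Omega>) =
      (\<Sum>i<s. \<Sum>j<s. \<integral>x. X i x * X j x \<partial>\<Omega>) / (real s)\<^sup>2 - m\<^sup>2"
    unfolding F_ort_eq using s_pos integrable_X mean_X int2 integral_proj(1)[of _ "\<lambda>u. (f u)\<^sup>2"]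
    by (intro mean_square_error_average) auto
  also have "\<dots> \<le> (\<Sum>i<s. \<Sum>j<s. \<integral>x. f (x i \<bullet> z) * f (x j \<bullet> z) \<partial>iid_space D s) / (real s)\<^sup>2 - m\<^sup>2"
  proof (intro diff_right_mono divide_right_mono sum_mono)
    fix i j assume "i \<in> {..<s}" "j \<in> {..<s}"
    then show "(\<integral>x. X i x * X j x \<partial>\<Omega>) \<le> (\<integral>x. f (x i \<bullet> z) * f (x j \<bullet> z) \<partial>iid_space D s)"
      using ort_product_le[OF int2, of i j] iid_product[of i j] sq[of i] by (cases "i = j") auto
  qed simp
  also have "\<dots> = (\<integral>x. (F_iid f z s x - m)\<^sup>2 \<partial>iid_space D s)"
    unfolding F_iid_def using s_pos int2 intX comp[of "\<lambda>w. f (w \<bullet> z)"] comp[of "\<lambda>w. (f (w \<bullet> z))\<^sup>2"]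
    by (intro I.mean_square_error_average[symmetric]) (simp_all add: F_true_def)
  finally show ?thesis .
qed

end


theorem theorem1:
  fixes D :: "(real^'n) measure" and H :: "(real^'n^'n) measure"
    and z :: "real^'n" and f g :: "real \<Rightarrow> real"
    and s k :: nat and blk :: "nat \<Rightarrow> nat" and pos :: "nat \<Rightarrow> 'n"
  assumes iso: "isotropic D"
    and nozero: "measure D {0} = 0"
    and haar: "haar_orthogonal H"
    and F1: "\<forall>u. f u = g \<bar>u\<bar>"
    and mono: "mono_on {0..} g \<or> monotone_on {0..} (\<le>) (\<ge>) g"
    and s_pos: "s > 0"
    and blocks: "\<forall>i<s. blk i < k" "inj_on (\<lambda>i. (blk i, pos i)) {..<s}"
    and intX: "integrable D (\<lambda>w. f (w \<bullet> z))"
  shows "integrable (ort_space D H k s) (F_ort f z blk pos s)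
         \<and> (\<integral>x. F_ort f z blk pos s x \<partial>ort_space D H k s) = F_true D f z
         \<and> (\<forall>\<epsilon>>0. emeasure (ort_space D H k s)
             {x \<in> space (ort_space D H k s). \<bar>F_ort f z blk pos s x - F_true D f z\<bar> \<ge> \<epsilon>}
           \<le> exp_neg (real s) (legendre (X_dist D f z) (F_true D f z + \<epsilon>))
             + exp_neg (real s) (legendre (X_dist D f z) (F_true D f z - \<epsilon>)))
         \<and> (\<forall>a b. (\<forall>u. a \<le> f u \<and> f u \<le> b) \<longrightarrow> (\<forall>\<epsilon>>0.
           measure (ort_space D H k s)
             {x \<in> space (ort_space D H k s). \<bar>F_ort f z blk pos s x - F_true D f z\<bar> \<ge> \<epsilon>}
           \<le> 2 * exp (- 2 * real s * \<epsilon>\<^sup>2 / (b - a)\<^sup>2)))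
         \<and> (integrable D (\<lambda>w. (f (w \<bullet> z))\<^sup>2) \<longrightarrow>
           (\<integral>x. (F_ort f z blk pos s x - F_true D f z)\<^sup>2 \<partial>ort_space D H k s)
           \<le> (\<integral>x. (F_iid f z s x - F_true D f z)\<^sup>2 \<partial>iid_space D s))"
proof -
  \<comment> \<open>On the half-line \<open>f\<close> and \<open>g\<close> coincide, so the
    monotonicity of \<open>g\<close> carries over to \<open>f\<close>.\<close>
  have f_nonneg: "f u = g u" if "0 \<le> u" for u
    using F1 that by simp
  interpret orthogonal_estimator D H s k blk pos z f
  proof
    show "monotone_on {0..} (\<le>) (\<le>) f \<or> monotone_on {0..} (\<le>) (\<ge>) f"
      using mono by (auto simp: monotone_on_def f_nonneg)
  qed (use iso haar blocks s_pos intX F1 in auto)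
  show ?thesis
    using F_ort_unbiased F_ort_cramer_chernoff F_ort_hoeffding F_ort_mse_le by blast
qed

end
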